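(* Let $f_\beta\colon\mathbb C^n\to\mathbb C^r$, $\beta\in\mathbb C^k$, be a polynomial system with $C_{m,n}$ irreducible. Suppose that the zero locus of $f_\beta$ in $\mathbb C^n$ is a complete intersection for a generic $\beta\in\mathbb C^k$. Then $C_{m,n}$ is a complete intersection.
   Context: $f_\beta$ is a system of $r$ polynomials on $\mathbb C^n$ whose coefficients are polynomials in $\beta\in\mathbb C^k$. The incidence variety is $$C_{m,n}=\{(x,\beta)\in\mathbb C^{mn}\times\mathbb C^k\mid f_\beta(x_i)=0,\ 1\le i\le m\}\subseteq\mathbb C^{mn+k},\qquad x=(x_1,\dots,x_m)\in(\mathbb C^n)^m,$$ with projections $\pi(x,\beta)=x$ and $\tau(x,\beta)=\beta$; $\mathcal H_{m,n}$ is the Zariski closure of $\pi(C_{m,n})$. Standing assumption: $C_{m,n}$ has a component dominating both $\pi$ (onto $\mathcal H_{m,n}$) and $\tau$, and $C_{m,n}$ has only this one component and is irreducible. Complete intersection refers to the given defining equations: the zero locus of $f_\beta$ (given by $r$ equations) is a complete intersection if it has codimension $r$ in $\mathbb C^n$, and $C_{m,n}$ (given by the $mr$ equations $f_\beta(x_1)=\dots=f_\beta(x_m)=0$) is a complete intersection if it has codimension $mr$ in $\mathbb C^{mn+k}$. *)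

theory Defs
  imports "HOL-Analysis.Analysis" "HOL-Library.Poly_Mapping"
begin

section \<open>Irreducibility, components and dimension in topological spaces\<close>

text \<open>A subset is irreducible if, in its subspace topology, it is nonempty and not the union of
  two proper closed subsets.\<close>

definition irreducible_in :: "'a topology \<Rightarrow> 'a set \<Rightarrow> bool" where
  "irreducible_in X S \<longleftrightarrow> S \<subseteq> topspace X \<and> S \<noteq> {} \<and>
     (\<forall>A B. closedin (subtopology X S) A \<longrightarrow> closedin (subtopology X S) B \<longrightarrow>
        S = A \<union> B \<longrightarrow> A = S \<or> B = S)"

definition irreducible_components :: "'a topology \<Rightarrow> 'a set \<Rightarrow> 'a set set" where
  "irreducible_components X S =
     {Z. Z \<subseteq> S \<and> irreducible_in X Z \<and>
         (\<forall>W. W \<subseteq> S \<longrightarrow> irreducible_in X W \<longrightarrow> Z \<subseteq> W \<longrightarrow> W = Z)}"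

text \<open>Krull dimension: the supremum of the lengths of strictly increasing chains of irreducible
  closed subsets. The supremum is taken in \<^typ>\<open>ereal\<close>, so the empty set has dimension
  \<open>-\<infinity>\<close>.\<close>

definition krull_dim :: "'a topology \<Rightarrow> 'a set \<Rightarrow> ereal" where
  "krull_dim X S = Sup {ereal (real d) | d. \<exists>Z :: nat \<Rightarrow> 'a set.
     (\<forall>i\<le>d. closedin (subtopology X S) (Z i) \<and> irreducible_in X (Z i)) \<and>
     (\<forall>i<d. Z i \<subset> Z (Suc i))}"


section \<open>Polynomials and the Zariski topology on complex affine space\<close>

text \<open>A polynomial in the variables \<open>'i\<close> maps exponent vectors to coefficients.\<close>

type_synonym ('i, 'a) mpoly = "('i \<Rightarrow>\<^sub>0 nat) \<Rightarrow>\<^sub>0 'a"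

definition monom_eval :: "('i::finite \<Rightarrow>\<^sub>0 nat) \<Rightarrow> complex ^ 'i \<Rightarrow> complex" where
  "monom_eval a x = (\<Prod>i\<in>UNIV. x $ i ^ Poly_Mapping.lookup a i)"

definition mpoly_eval :: "('i::finite, complex) mpoly \<Rightarrow> complex ^ 'i \<Rightarrow> complex" where
  "mpoly_eval p x = (\<Sum>a\<in>Poly_Mapping.keys p. Poly_Mapping.lookup p a * monom_eval a x)"

definition zero_locus :: "('i::finite, complex) mpoly set \<Rightarrow> (complex ^ 'i) set" where
  "zero_locus P = {x. \<forall>p\<in>P. mpoly_eval p x = 0}"

definition zariski :: "(complex ^ 'i::finite) topology" where
  "zariski = topology (\<lambda>U. \<exists>P. U = - zero_locus P)"

lemma monom_eval_add: "monom_eval (a + b) x = monom_eval a x * monom_eval b x"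
  by (simp add: monom_eval_def lookup_add power_add prod.distrib)

lemma monom_eval_0 [simp]: "monom_eval 0 x = 1"
  by (simp add: monom_eval_def)

lemma mpoly_eval_superset:
  assumes "finite A" "Poly_Mapping.keys p \<subseteq> A"
  shows "mpoly_eval p x = (\<Sum>a\<in>A. Poly_Mapping.lookup p a * monom_eval a x)"
  unfolding mpoly_eval_def
  by (rule sum.mono_neutral_left) (use assms in \<open>auto simp: in_keys_iff\<close>)

lemma mpoly_eval_0 [simp]: "mpoly_eval 0 x = 0"
  by (simp add: mpoly_eval_def)

lemma mpoly_eval_1 [simp]: "mpoly_eval 1 x = 1"
  by (simp add: mpoly_eval_def)

lemma mpoly_eval_single: "mpoly_eval (Poly_Mapping.single a c) x = c * monom_eval a x"
  by (subst mpoly_eval_superset[of "{a}"]) auto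

lemma mpoly_eval_add: "mpoly_eval (p + q) x = mpoly_eval p x + mpoly_eval q x"
proof -
  let ?A = "Poly_Mapping.keys p \<union> Poly_Mapping.keys q"
  have "mpoly_eval (p + q) x = (\<Sum>a\<in>?A. Poly_Mapping.lookup (p + q) a * monom_eval a x)"
    using Poly_Mapping.keys_add[of p q] by (intro mpoly_eval_superset) auto
  moreover have "mpoly_eval p x = (\<Sum>a\<in>?A. Poly_Mapping.lookup p a * monom_eval a x)"
    by (intro mpoly_eval_superset) auto
  moreover have "mpoly_eval q x = (\<Sum>a\<in>?A. Poly_Mapping.lookup q a * monom_eval a x)"
    by (intro mpoly_eval_superset) auto
  ultimately show ?thesis
    by (simp add: lookup_add algebra_simps sum.distrib)
qed

lemma mpoly_eval_sum: "mpoly_eval (\<Sum>j\<in>J. f j) x = (\<Sum>j\<in>J. mpoly_eval (f j) x)"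
  by (induction J rule: infinite_finite_induct) (simp_all add: mpoly_eval_add)

lemma mpoly_as_sum:
  "p = (\<Sum>a\<in>Poly_Mapping.keys p. Poly_Mapping.single a (Poly_Mapping.lookup p a))"
  by (rule poly_mapping_eqI)
     (auto simp: lookup_sum lookup_single when_def in_keys_iff sum.delta)

lemma mpoly_eval_mult: "mpoly_eval (p * q) x = mpoly_eval p x * mpoly_eval q x"
proof -
  have "p * q = (\<Sum>a\<in>Poly_Mapping.keys p. \<Sum>b\<in>Poly_Mapping.keys q.
      Poly_Mapping.single (a + b) (Poly_Mapping.lookup p a * Poly_Mapping.lookup q b))"
    by (subst (1) mpoly_as_sum[of p], subst (1) mpoly_as_sum[of q])
       (simp add: sum_product mult_single)
  then show ?thesis
    by (simp add: mpoly_eval_sum mpoly_eval_single monom_eval_add mpoly_eval_def[of p]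
        mpoly_eval_def[of q] sum_product mult_ac)
qed

lemma zero_locus_Un: "zero_locus P \<union> zero_locus Q = zero_locus {p * q | p q. p \<in> P \<and> q \<in> Q}"
proof
  show "zero_locus {p * q | p q. p \<in> P \<and> q \<in> Q} \<subseteq> zero_locus P \<union> zero_locus Q"
  proof
    fix x assume x: "x \<in> zero_locus {p * q | p q. p \<in> P \<and> q \<in> Q}"
    have "mpoly_eval p x = 0 \<or> mpoly_eval q x = 0" if "p \<in> P" "q \<in> Q" for p q
    proof -
      have "mpoly_eval (p * q) x = 0" using x that unfolding zero_locus_def by blast
      then show ?thesis by (simp add: mpoly_eval_mult)
    qed
    then show "x \<in> zero_locus P \<union> zero_locus Q" unfolding zero_locus_def by blast
  qed
qed (auto simp: zero_locus_def mpoly_eval_mult)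

lemma istopology_zariski:
  "istopology (\<lambda>U. \<exists>P. U = - zero_locus (P :: ('i::finite, complex) mpoly set))"
  unfolding istopology_def
proof (intro conjI allI impI)
  fix S T :: "(complex ^ 'i) set"
  assume "\<exists>P. S = - zero_locus P" "\<exists>P. T = - zero_locus P"
  then obtain P Q where "S = - zero_locus P" "T = - zero_locus Q" by blast
  then have "S \<inter> T = - zero_locus {p * q | p q. p \<in> P \<and> q \<in> Q}"
    by (simp flip: zero_locus_Un)
  then show "\<exists>P. S \<inter> T = - zero_locus P" by blast
next
  fix K :: "(complex ^ 'i) set set"
  assume "\<forall>U\<in>K. \<exists>P. U = - zero_locus P"
  then obtain P where P: "\<And>U. U \<in> K \<Longrightarrow> U = - zero_locus (P U)" by metis
  have "zero_locus (\<Union>U\<in>K. P U) = (\<Inter>U\<in>K. zero_locus (P U))"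
    by (auto simp: zero_locus_def)
  also have "\<dots> = (\<Inter>U\<in>K. - U)" using P by force
  finally have "\<Union>K = - zero_locus (\<Union>U\<in>K. P U)" by auto
  then show "\<exists>P. \<Union>K = - zero_locus P" by blast
qed

lemma openin_zariski: "openin zariski U \<longleftrightarrow> (\<exists>P. U = - zero_locus P)"
  unfolding zariski_def topology_inverse'[OF istopology_zariski] ..

lemma topspace_zariski [simp]: "topspace zariski = UNIV"
proof -
  have "openin zariski (UNIV :: (complex ^ 'a) set)"
    unfolding openin_zariski by (rule exI[of _ "{1}"]) (simp add: zero_locus_def)
  then show ?thesis using openin_subset by blast
qed

lemma closedin_zariski: "closedin zariski V \<longleftrightarrow> (\<exists>P. V = zero_locus P)"
  unfolding closedin_def openin_zariski by (auto simp: Compl_eq_Diff_UNIV[symmetric])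

text \<open>A property holds for generic \<open>\<beta>\<close> if it holds on a nonempty Zariski open subset.\<close>

definition generically :: "(complex ^ 'k::finite \<Rightarrow> bool) \<Rightarrow> bool" where
  "generically Q \<longleftrightarrow> (\<exists>U. openin zariski U \<and> U \<noteq> {} \<and> (\<forall>\<beta>\<in>U. Q \<beta>))"

definition dominates ::
  "(complex ^ 'i::finite \<Rightarrow> complex ^ 'j::finite) \<Rightarrow> (complex ^ 'i) set \<Rightarrow> (complex ^ 'j) set \<Rightarrow> bool"
  where "dominates \<phi> Z Y \<longleftrightarrow> \<phi> ` Z \<subseteq> Y \<and> Y \<subseteq> zariski closure_of (\<phi> ` Z)"

definition codim :: "(complex ^ 'i::finite) set \<Rightarrow> ereal" where
  "codim V = ereal (real CARD('i)) - krull_dim zariski V"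


section \<open>Parametrised polynomial systems and the incidence variety\<close>

text \<open>A system of \<open>CARD('r)\<close> polynomials in \<open>CARD('n)\<close> variables, whose coefficients are
  polynomials in \<open>CARD('k)\<close> parameters.\<close>

type_synonym ('n, 'k, 'r) param_system = "'r \<Rightarrow> ('n, ('k, complex) mpoly) mpoly"

definition specialize ::
  "('n, ('k::finite, complex) mpoly) mpoly \<Rightarrow> complex ^ 'k \<Rightarrow> ('n, complex) mpoly" where
  "specialize F \<beta> = Poly_Mapping.map (\<lambda>c. mpoly_eval c \<beta>) F"

definition system_eval ::
  "('n::finite, 'k::finite, 'r::finite) param_system \<Rightarrow> complex ^ 'k \<Rightarrow> complex ^ 'n \<Rightarrow> complex ^ 'r"
  where "system_eval f \<beta> x = (\<chi> j. mpoly_eval (specialize (f j) \<beta>) x)"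

text \<open>The coordinates of \<open>\<complex>\<^bsup>mn+k\<^esup>\<close> are indexed by \<open>('m \<times> 'n) + 'k\<close>: the index \<open>Inl (i, l)\<close>
  is the \<open>l\<close>-th coordinate of \<open>x\<^sub>i\<close>, the index \<open>Inr l\<close> is the \<open>l\<close>-th coordinate of \<open>\<beta>\<close>.\<close>

definition proj_x :: "complex ^ (('m::finite \<times> 'n::finite) + 'k::finite) \<Rightarrow> complex ^ ('m \<times> 'n)"
  where "proj_x z = (\<chi> il. z $ Inl il)"

definition proj_beta :: "complex ^ (('m::finite \<times> 'n::finite) + 'k::finite) \<Rightarrow> complex ^ 'k"
  where "proj_beta z = (\<chi> l. z $ Inr l)"

definition point_of :: "complex ^ ('m::finite \<times> 'n::finite) \<Rightarrow> 'm \<Rightarrow> complex ^ 'n"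
  where "point_of x i = (\<chi> l. x $ (i, l))"

definition incidence_variety ::
  "('n::finite, 'k::finite, 'r::finite) param_system \<Rightarrow>
     (complex ^ (('m::finite \<times> 'n) + 'k)) set" where
  "incidence_variety f =
     {z. \<forall>i. system_eval f (proj_beta z) (point_of (proj_x z) i) = 0}"

end

theory Submission
  imports Defs "HOL-Computational_Algebra.Fundamental_Theorem_Algebra"
begin

text \<open>
  The idea is a dimension count along \<open>\<tau>\<close>. The fibre of \<open>C\<close> over \<open>\<beta>\<close> is the \<open>m\<close>-fold power of the
  solution set \<open>V\<^sub>\<beta>\<close> of \<open>f\<^sub>\<beta>\<close>, and for generic \<open>\<beta>\<close> the set \<open>V\<^sub>\<beta>\<close> has dimension \<open>n - r\<close>. As \<open>C\<close> is irreducible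
  and dominates \<open>\<complex>\<^sup>k\<close>, its dimension should be \<open>k + m(n - r)\<close>, and this means codimension \<open>mr\<close>.

  To measure dimension, call a set \<open>T\<close> of coordinates independent on \<open>V\<close> if a polynomial in these
  coordinates that vanishes on \<open>V\<close> vanishes everywhere (\<open>indep_mod T (vanishing_ideal V)\<close>), that is, if
  \<open>V\<close> has Zariski dense image in the coordinate space \<open>\<complex>\<^sup>T\<close>. Krull dimension and independence are linked
  in both directions.

  \<^item> A closed set with an independent set of \<open>d\<close> coordinates contains a chain of \<open>d + 1\<close> irreducible
  closed sets (\<open>has_chain_of_indep\<close>): for suitable \<open>\<xi>\<close>, the slice \<open>x\<^sub>j = \<xi>\<close> still has the other \<open>d - 1\<close>
  coordinates independent. Such a slice is found with \<open>extend_point\<close>: a point of \<open>\<complex>\<^sup>T\<close>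
  outside a hypersurface lifts to the variety, one coordinate at a time, by solving a polynomial
  equation for each new coordinate. The same lemma yields the Nullstellensatz for prime ideals.

  \<^item> If \<open>T\<close> is maximal independent on an irreducible \<open>V\<close>, then no chain in \<open>V\<close> is longer than
  \<open>card T\<close> (\<open>chain_length_le\<close>). A chain of length \<open>n\<close> gives \<open>n\<close> polynomials without
  any algebraic relation on \<open>V\<close>, one for each inclusion. But every coordinate is algebraic over
  the coordinates in \<open>T\<close>, so up to a common denominator the \<open>(t + 1)\<^sup>n\<close> monomials in these polynomials with
  exponents at most \<open>t\<close> lie in a space of dimension \<open>O(t\<^bsup>card T\<^esup>)\<close>, which forces \<open>n \<le> card T\<close>.

  For the lower bound, some set \<open>S\<close> of at least \<open>n - r\<close> coordinates is independent on \<open>V\<^sub>\<beta>\<close> for a Zariski dense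
  set of \<open>\<beta>\<close>, because there are only finitely many \<open>S\<close>. Then the \<open>k\<close> parameters and the coordinates from \<open>S\<close>
  of all \<open>m\<close> points are independent on \<open>C\<close> (\<open>has_chain_incidence_variety\<close>). For the upper bound, the \<open>k\<close>
  parameters are independent on \<open>C\<close> by dominance. Extend them to a maximal independent \<open>T\<close>. For a
  generic \<open>\<beta>\<close> the coordinates of the \<open>i\<close>-th point that occur in \<open>T\<close> are independent on \<open>V\<^sub>\<beta>\<close>, so there are at
  most \<open>n - r\<close> of them for each \<open>i\<close> (\<open>chain_length_incidence_variety\<close>).
\<close>

section \<open>Subrings and prime ideals\<close>

text \<open>Subrings and ideals are plain sets in a ring type. In this way a coordinate ring is
  handled as the polynomial ring together with a prime ideal \<open>Q\<close>, where membership in \<open>Q\<close> plays the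
  role of being zero.\<close>

definition is_subring :: "'a::comm_ring_1 set \<Rightarrow> bool" where
  "is_subring A \<longleftrightarrow> 1 \<in> A \<and> (\<forall>x\<in>A. \<forall>y\<in>A. x - y \<in> A \<and> x * y \<in> A)"

definition is_ideal :: "'a::comm_ring_1 set \<Rightarrow> bool" where
  "is_ideal I \<longleftrightarrow> 0 \<in> I \<and> (\<forall>x\<in>I. \<forall>y\<in>I. x + y \<in> I) \<and> (\<forall>x\<in>I. \<forall>r. r * x \<in> I)"

definition is_prime_ideal :: "'a::comm_ring_1 set \<Rightarrow> bool" where
  "is_prime_ideal Q \<longleftrightarrow> is_ideal Q \<and> 1 \<notin> Q \<and> (\<forall>x y. x * y \<in> Q \<longrightarrow> x \<in> Q \<or> y \<in> Q)"

lemma subring_closed: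
  assumes "is_subring A"
  shows "0 \<in> A" "1 \<in> A" "x \<in> A \<Longrightarrow> y \<in> A \<Longrightarrow> x - y \<in> A" "x \<in> A \<Longrightarrow> - x \<in> A"
    "x \<in> A \<Longrightarrow> y \<in> A \<Longrightarrow> x + y \<in> A" "x \<in> A \<Longrightarrow> y \<in> A \<Longrightarrow> x * y \<in> A" "x \<in> A \<Longrightarrow> x ^ n \<in> A"
proof -
  show 0: "0 \<in> A" using assms unfolding is_subring_def by (metis diff_self)
  show 1: "1 \<in> A" using assms unfolding is_subring_def by blast
  show m: "x \<in> A \<Longrightarrow> y \<in> A \<Longrightarrow> x - y \<in> A" for x y using assms unfolding is_subring_def by blast
  show u: "x \<in> A \<Longrightarrow> - x \<in> A" for x using m[OF 0] by simp
  show "x \<in> A \<Longrightarrow> y \<in> A \<Longrightarrow> x + y \<in> A" using m[of x "- y"] u by simp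
  show t: "x \<in> A \<Longrightarrow> y \<in> A \<Longrightarrow> x * y \<in> A" for x y using assms unfolding is_subring_def by blast
  show "x \<in> A \<Longrightarrow> x ^ n \<in> A" by (induction n) (auto intro: t 1)
qed

lemma ideal_closed:
  assumes "is_ideal I"
  shows "0 \<in> I" "x \<in> I \<Longrightarrow> y \<in> I \<Longrightarrow> x + y \<in> I" "x \<in> I \<Longrightarrow> r * x \<in> I" "x \<in> I \<Longrightarrow> x * r \<in> I"
    "x \<in> I \<Longrightarrow> - x \<in> I" "x \<in> I \<Longrightarrow> y \<in> I \<Longrightarrow> x - y \<in> I"
    "(\<And>k. k \<in> K \<Longrightarrow> f k \<in> I) \<Longrightarrow> sum f K \<in> I"
proof -
  show 0: "0 \<in> I" and a: "x \<in> I \<Longrightarrow> y \<in> I \<Longrightarrow> x + y \<in> I" and m: "x \<in> I \<Longrightarrow> r * x \<in> I" for x y r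
    using assms unfolding is_ideal_def by auto
  show "x \<in> I \<Longrightarrow> x * r \<in> I" using m[of x r] by (simp add: mult.commute[of x r])
  show u: "x \<in> I \<Longrightarrow> - x \<in> I" for x using m[of x "- 1"] by simp
  show "x \<in> I \<Longrightarrow> y \<in> I \<Longrightarrow> x - y \<in> I" using a[of x "- y"] u by simp
  show "(\<And>k. k \<in> K \<Longrightarrow> f k \<in> I) \<Longrightarrow> sum f K \<in> I"
    by (induction K rule: infinite_finite_induct) (auto intro: 0 a)
qed

lemma prime_idealD:
  assumes "is_prime_ideal Q"
  shows "is_ideal Q" "1 \<notin> Q" "x * y \<in> Q \<longleftrightarrow> x \<in> Q \<or> y \<in> Q" "x ^ n \<in> Q \<Longrightarrow> x \<in> Q"
proof -
  show i: "is_ideal Q" and 1: "1 \<notin> Q" using assms unfolding is_prime_ideal_def by auto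
  show p: "x * y \<in> Q \<longleftrightarrow> x \<in> Q \<or> y \<in> Q" for x y
    using assms ideal_closed[OF i] unfolding is_prime_ideal_def by blast
  show "x ^ n \<in> Q \<Longrightarrow> x \<in> Q" using 1 by (induction n) (auto simp: p)
qed

lemma ideal_diff_iff:
  assumes "is_ideal I" "x - y \<in> I"
  shows "x \<in> I \<longleftrightarrow> y \<in> I"
  using ideal_closed(2)[OF assms(1), of "x - y" y] ideal_closed(6)[OF assms(1), of x "x - y"] assms(2)
  by auto

lemma prime_prod_notin:
  assumes "is_prime_ideal Q" "finite J" "\<And>j. j \<in> J \<Longrightarrow> a j \<notin> Q"
  shows "prod a J \<notin> Q"
  using assms(2,3) by (induction) (auto simp: prime_idealD[OF assms(1)])

text \<open>A maximal element among the ideals above \<open>I\<close> that avoid \<open>S\<close> is prime: if \<open>x\<close> and \<open>y\<close> lie outside it, then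
  adjoining either of them reaches \<open>S\<close>, and the product of the two elements reached shows
  \<open>xy\<close> to be outside as well.\<close>

lemma prime_ideal_avoiding:
  fixes I S :: "'a::comm_ring_1 set"
  assumes "is_ideal I" "1 \<in> S" "\<And>x y. x \<in> S \<Longrightarrow> y \<in> S \<Longrightarrow> x * y \<in> S" "I \<inter> S = {}"
  obtains Q where "is_prime_ideal Q" "I \<subseteq> Q" "Q \<inter> S = {}"
proof -
  define F where "F = {J. is_ideal J \<and> I \<subseteq> J \<and> J \<inter> S = {}}"
  have "\<exists>M\<in>F. \<forall>X\<in>F. M \<subseteq> X \<longrightarrow> X = M"
  proof (rule subset_Zorn_nonempty)
    show "F \<noteq> {}" using assms unfolding F_def by blast
    fix C assume C: "C \<noteq> {}" "subset.chain F C"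
    have CF: "J \<in> C \<Longrightarrow> is_ideal J \<and> I \<subseteq> J \<and> J \<inter> S = {}" for J
      using C unfolding subset.chain_def F_def by blast
    have "is_ideal (\<Union>C)"
      unfolding is_ideal_def
    proof (intro conjI ballI allI)
      show "0 \<in> \<Union>C" using C CF ideal_closed(1) by blast
      fix x assume x: "x \<in> \<Union>C"
      then show "r * x \<in> \<Union>C" for r using CF ideal_closed(3) by blast
      fix y assume y: "y \<in> \<Union>C"
      from x y obtain J K where JK: "J \<in> C" "x \<in> J" "K \<in> C" "y \<in> K" by blast
      then have "J \<subseteq> K \<or> K \<subseteq> J" using C unfolding subset.chain_def by blast
      then show "x + y \<in> \<Union>C" using JK CF ideal_closed(2) by blast
    qed
    then show "\<Union>C \<in> F" using C CF unfolding F_def by blast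
  qed
  then obtain M where MF: "M \<in> F" and mx: "\<And>X. X \<in> F \<Longrightarrow> M \<subseteq> X \<Longrightarrow> X = M" by metis
  have M: "is_ideal M" "I \<subseteq> M" "M \<inter> S = {}" using MF unfolding F_def by simp_all
  have max: "X = M" if "is_ideal X" "X \<inter> S = {}" "M \<subseteq> X" for X
  proof (rule mx[OF _ that(3)])
    show "X \<in> F" using that subset_trans[OF M(2) that(3)] unfolding F_def by simp
  qed
  have ext: "\<exists>m\<in>M. \<exists>r. m + r * x \<in> S" if "x \<notin> M" for x
  proof (rule ccontr)
    assume no: "\<not> ?thesis"
    define X where "X = {m + r * x | m r. m \<in> M}"
    have "is_ideal X" unfolding is_ideal_def
    proof (intro conjI ballI allI)
      have "0 + 0 * x \<in> X" unfolding X_def using ideal_closed(1)[OF M(1)] by blast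
      then show "0 \<in> X" by simp
      fix y assume "y \<in> X"
      then obtain m r where y: "y = m + r * x" "m \<in> M" unfolding X_def by blast
      have "s * y = s * m + (s * r) * x" for s by (simp add: y algebra_simps)
      then show "s * y \<in> X" for s using ideal_closed(3)[OF M(1) y(2)] unfolding X_def by blast
      fix z assume "z \<in> X"
      then obtain m' r' where z: "z = m' + r' * x" "m' \<in> M" unfolding X_def by blast
      have "y + z = (m + m') + (r + r') * x" by (simp add: y z algebra_simps)
      then show "y + z \<in> X" using ideal_closed(2)[OF M(1) y(2) z(2)] unfolding X_def by blast
    qed
    moreover have "X \<inter> S = {}" using no unfolding X_def by blast
    moreover have "M \<subseteq> X"
    proof
      fix m assume "m \<in> M" then have "m + 0 * x \<in> X" unfolding X_def by blast
      then show "m \<in> X" by simp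
    qed
    ultimately have "X = M" using max by blast
    moreover have "0 + 1 * x \<in> X" unfolding X_def using ideal_closed(1)[OF M(1)] by blast
    ultimately show False using that by simp
  qed
  have "is_prime_ideal M"
    unfolding is_prime_ideal_def
  proof (intro conjI allI impI)
    show "1 \<notin> M" using M(3) assms(2) by blast
    fix x y assume xy: "x * y \<in> M"
    show "x \<in> M \<or> y \<in> M"
    proof (rule ccontr)
      assume "\<not> ?thesis"
      with ext obtain m r m' r' where mr: "m \<in> M" "m + r * x \<in> S" "m' \<in> M" "m' + r' * y \<in> S" by metis
      have "(m + r * x) * (m' + r' * y) = m * (m' + r' * y) + ((r * x) * m' + (r * r') * (x * y))"
        by (simp add: algebra_simps)
      also have "\<dots> \<in> M" by (intro ideal_closed(2)[OF M(1)] ideal_closed(4)[OF M(1) mr(1)]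
            ideal_closed(3)[OF M(1) mr(3)] ideal_closed(3)[OF M(1) xy])
      finally show False using assms(3)[OF mr(2,4)] M(3) by blast
    qed
  qed (fact M(1))
  then show ?thesis using that M by blast
qed

section \<open>Polynomial relations modulo a prime ideal\<close>

definition coeffs_in :: "'a::comm_ring_1 set \<Rightarrow> 'a poly \<Rightarrow> bool" where
  "coeffs_in A F \<longleftrightarrow> (\<forall>n. coeff F n \<in> A)"

lemma coeffs_in_closed:
  assumes "is_subring A"
  shows "coeffs_in A 0" "c \<in> A \<Longrightarrow> coeffs_in A (monom c n)" "c \<in> A \<Longrightarrow> coeffs_in A [:c:]"
    "coeffs_in A F \<Longrightarrow> coeffs_in A G \<Longrightarrow> coeffs_in A (F + G)"
    "coeffs_in A F \<Longrightarrow> coeffs_in A G \<Longrightarrow> coeffs_in A (F - G)"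
    "coeffs_in A F \<Longrightarrow> coeffs_in A G \<Longrightarrow> coeffs_in A (F * G)"
    "c \<in> A \<Longrightarrow> coeffs_in A F \<Longrightarrow> coeffs_in A (smult c F)"
proof -
  note cl = subring_closed[OF assms]
  have s: "(\<And>k. k \<in> K \<Longrightarrow> f k \<in> A) \<Longrightarrow> sum f K \<in> A" for f :: "nat \<Rightarrow> 'a" and K
    by (induction K rule: infinite_finite_induct) (auto intro: cl)
  show "coeffs_in A F \<Longrightarrow> coeffs_in A G \<Longrightarrow> coeffs_in A (F * G)"
    unfolding coeffs_in_def coeff_mult by (intro allI s cl) auto
qed (auto simp: coeffs_in_def coeff_pCons split: nat.split intro: subring_closed[OF assms])

lemma poly_in_ideal:
  assumes "is_ideal I" "coeffs_in I F"
  shows "poly F x \<in> I"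
  unfolding poly_altdef using assms
  by (intro ideal_closed(7)[OF assms(1)] ideal_closed(4)[OF assms(1)]) (auto simp: coeffs_in_def)

text \<open>Dropping leading terms whose coefficients lie in \<open>I\<close> gives a polynomial whose degree is its true
  degree modulo \<open>I\<close>.\<close>

lemma truncate_mod_ideal:
  assumes A: "is_subring A" and I: "is_ideal I" and "coeffs_in A F" "\<not> coeffs_in I F"
  shows "\<exists>F'. coeffs_in A F' \<and> lead_coeff F' \<notin> I \<and> degree F' \<le> degree F \<and> (\<forall>x. poly F x - poly F' x \<in> I)"
  using assms(3,4)
proof (induction "degree F" arbitrary: F rule: less_induct)
  case less
  show ?case
  proof (cases "lead_coeff F \<in> I")
    case False then show ?thesis using less.prems ideal_closed(1)[OF I] by (intro exI[of _ F]) auto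
  next
    case True
    define G where "G = F - monom (lead_coeff F) (degree F)"
    have GA: "coeffs_in A G" unfolding G_def using less.prems A
      by (intro coeffs_in_closed) (auto simp: coeffs_in_def)
    have GI: "\<not> coeffs_in I G"
    proof
      assume "coeffs_in I G"
      then have "coeff G n + coeff (monom (lead_coeff F) (degree F)) n \<in> I" for n
        using True ideal_closed[OF I] by (intro ideal_closed(2)[OF I]) (auto simp: coeffs_in_def)
      then show False using less.prems(2) unfolding G_def coeffs_in_def by simp
    qed
    then have "G \<noteq> 0" using ideal_closed(1)[OF I] unfolding coeffs_in_def by auto
    have "degree G \<le> degree F" unfolding G_def
      by (rule degree_diff_le) (auto simp: degree_monom_le)
    moreover have "coeff G (degree F) = 0" by (simp add: G_def)
    ultimately have lt: "degree G < degree F" using \<open>G \<noteq> 0\<close>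
      by (metis le_neq_implies_less leading_coeff_0_iff)
    obtain F' where F': "coeffs_in A F'" "lead_coeff F' \<notin> I" "degree F' \<le> degree G"
      "\<forall>x. poly G x - poly F' x \<in> I" using less.hyps[OF lt GA GI] by blast
    have "poly F x - poly F' x \<in> I" for x
    proof -
      have "poly F x - poly F' x = (poly G x - poly F' x) + lead_coeff F * x ^ degree F"
        by (simp add: G_def poly_monom)
      also have "\<dots> \<in> I" using F' True by (intro ideal_closed(2,4)[OF I]) auto
      finally show ?thesis .
    qed
    then show ?thesis using F' lt by (intro exI[of _ F']) auto
  qed
qed

text \<open>Division without inverting the leading coefficient of \<open>F\<close>: the dividend is multiplied by a power of
  it, which keeps all coefficients in \<open>A\<close>. The bound on \<open>degree H\<close> is what makes the quotient
  subject to the minimality of a relation later.\<close>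

lemma pseudo_division:
  assumes A: "is_subring A" and F: "coeffs_in A F" and "coeffs_in A G"
  shows "\<exists>M H R. coeffs_in A H \<and> coeffs_in A R \<and> smult (lead_coeff F ^ M) G = H * F + R \<and>
    (R = 0 \<or> degree R < degree F) \<and> degree H \<le> degree G - degree F"
  using assms(3)
proof (induction "degree G" arbitrary: G rule: less_induct)
  case less
  note cl = coeffs_in_closed[OF A] subring_closed[OF A]
  have lA: "lead_coeff F \<in> A" "lead_coeff G \<in> A" using F less.prems unfolding coeffs_in_def by auto
  show ?case
  proof (cases "degree G < degree F")
    case True then show ?thesis using less.prems cl by (intro exI[of _ 0] exI[of _ "0::'a poly"] exI[of _ G]) auto
  next
    case False
    define N where "N = monom (lead_coeff G) (degree G - degree F)"
    define G' where "G' = smult (lead_coeff F) G - N * F"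
    have NA: "coeffs_in A N" unfolding N_def using lA cl by blast
    have G'A: "coeffs_in A G'" unfolding G'_def using lA NA F less.prems by (intro cl)
    have dN: "degree N \<le> degree G - degree F" unfolding N_def by (rule degree_monom_le)
    have d1: "degree (N * F) \<le> degree G" using degree_mult_le[of N F] dN False by linarith
    have dG': "degree G' \<le> degree G" unfolding G'_def
      using d1 degree_smult_le[of "lead_coeff F" G] by (intro degree_diff_le) auto
    have "coeff (N * F) (degree G) = coeff N (degree G - degree F) * lead_coeff F"
    proof -
      have "coeff (F * N) (degree G) = coeff (monom (lead_coeff G) (degree G - degree F) * F) (degree G)"
        by (simp add: N_def mult.commute)
      also have "\<dots> = lead_coeff G * coeff F (degree G - (degree G - degree F))"
        using False by (subst coeff_monom_mult) auto
      finally show ?thesis using False by (simp add: N_def mult.commute)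
    qed
    then have c0: "coeff G' (degree G) = 0" by (simp add: G'_def N_def)
    show ?thesis
    proof (cases "degree G' < degree G")
      case True
      then obtain M H R where *: "coeffs_in A H" "coeffs_in A R" "smult (lead_coeff F ^ M) G' = H * F + R"
        "R = 0 \<or> degree R < degree F" "degree H \<le> degree G' - degree F"
        using less.hyps[OF True G'A] by blast
      have "smult (lead_coeff F ^ Suc M) G = smult (lead_coeff F ^ M) (G' + N * F)"
        by (simp add: G'_def mult.commute)
      also have "\<dots> = (H + smult (lead_coeff F ^ M) N) * F + R"
        by (simp add: smult_add_right * algebra_simps)
      finally have "smult (lead_coeff F ^ Suc M) G = (H + smult (lead_coeff F ^ M) N) * F + R" .
      moreover have "degree (H + smult (lead_coeff F ^ M) N) \<le> degree G - degree F"
        using * dG' dN degree_smult_le[of "lead_coeff F ^ M" N] by (intro degree_add_le) auto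
      moreover have "coeffs_in A (H + smult (lead_coeff F ^ M) N)" using * lA NA by (intro cl)
      ultimately show ?thesis using * by blast
    next
      case False
      then have "G' = 0" using dG' c0 by (metis le_neq_implies_less leading_coeff_0_iff)
      then have "smult (lead_coeff F ^ 1) G = N * F + 0" by (simp add: G'_def)
      then show ?thesis using NA dN cl(1) by blast
    qed
  qed
qed

text \<open>This plays the role of the minimal polynomial of \<open>x\<close> over the fraction field of \<open>A\<close> modulo \<open>Q\<close>.\<close>

definition minimal_relation :: "'a::comm_ring_1 set \<Rightarrow> 'a set \<Rightarrow> 'a \<Rightarrow> 'a poly \<Rightarrow> bool" where
  "minimal_relation A Q x F \<longleftrightarrow> coeffs_in A F \<and> poly F x \<in> Q \<and> lead_coeff F \<notin> Q \<and>
     (\<forall>G. coeffs_in A G \<longrightarrow> poly G x \<in> Q \<longrightarrow> degree G < degree F \<longrightarrow> coeffs_in Q G)"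

lemma minimal_relation_exists:
  assumes A: "is_subring A" and Q: "is_ideal Q"
    and F: "coeffs_in A F" "poly F x \<in> Q" "\<not> coeffs_in Q F"
  shows "\<exists>F. minimal_relation A Q x F"
proof -
  define rel where "rel F \<longleftrightarrow> coeffs_in A F \<and> poly F x \<in> Q \<and> \<not> coeffs_in Q F" for F
  obtain F where F: "rel F" "\<And>G. rel G \<Longrightarrow> degree F \<le> degree G"
    using ex_has_least_nat[of rel F degree] assms unfolding rel_def by blast
  then obtain F' where F': "coeffs_in A F'" "lead_coeff F' \<notin> Q" "degree F' \<le> degree F"
    "poly F x - poly F' x \<in> Q"
    using truncate_mod_ideal[OF A Q, of F] unfolding rel_def by blast
  have "poly F' x \<in> Q" using ideal_diff_iff[OF Q F'(4)] F(1) unfolding rel_def by blast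
  moreover have "\<not> coeffs_in Q F'" using F'(2) unfolding coeffs_in_def by blast
  ultimately have "rel F'" using F' unfolding rel_def by blast
  then show ?thesis using F(2) F' unfolding minimal_relation_def rel_def
    by (metis dual_order.strict_trans1 leD)
qed

lemma minimal_relation_degree:
  assumes "minimal_relation A Q x F"
  shows "degree F > 0"
proof (rule ccontr)
  assume "\<not> ?thesis"
  then have "poly F x = lead_coeff F" by (metis degree_0_id gr0I mult_zero_right
    add.right_neutral poly_0 poly_pCons)
  then show False using assms unfolding minimal_relation_def by auto
qed

lemma minimal_relation_reduce:
  assumes A: "is_subring A" and Q: "is_prime_ideal Q" and F: "minimal_relation A Q x F" 
    and G: "coeffs_in A G"
  obtains M H R where "coeffs_in A H" "coeffs_in A R" "smult (lead_coeff F ^ M) G = H * F + R"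
    "degree R < degree F" 
  using pseudo_division[OF A _ G, of F] minimal_relation_degree[OF F] F unfolding minimal_relation_def
  by (metis degree_0)

text \<open>Every element of \<open>A[x]\<close> outside \<open>Q\<close> has a multiple in \<open>A\<close> that is still outside \<open>Q\<close>, because \<open>F\<close> is
  irreducible over the fraction field. The proof is the Euclidean algorithm: dividing \<open>F\<close> by \<open>G\<close> leaves a
  remainder \<open>R\<close> of smaller degree than \<open>G\<close> whose value at \<open>x\<close> is, modulo \<open>Q\<close>, a multiple of the value of \<open>G\<close>,
  and by minimality of \<open>F\<close> this value is not in \<open>Q\<close>.\<close>

lemma minimal_relation_inverse:
  assumes A: "is_subring A" and Q: "is_prime_ideal Q" and F: "minimal_relation A Q x F"
    and G: "coeffs_in A G" "poly G x \<notin> Q"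
  shows "\<exists>c\<in>A - Q. \<exists>U. coeffs_in A U \<and> poly U x * poly G x - c \<in> Q"
proof -
  note I = prime_idealD(1)[OF Q]
  note cl = coeffs_in_closed[OF A] subring_closed[OF A]
  have FA: "coeffs_in A F" "poly F x \<in> Q" "lead_coeff F \<notin> Q" using F unfolding minimal_relation_def by auto
  have small: "\<exists>c\<in>A - Q. \<exists>U. coeffs_in A U \<and> poly U x * poly G x - c \<in> Q"
    if "coeffs_in A G" "poly G x \<notin> Q" "degree G < degree F" for G
    using that
  proof (induction "degree G" arbitrary: G rule: less_induct)
    case less
    have "\<not> coeffs_in Q G" using less.prems poly_in_ideal[OF I] by blast
    then obtain G' where G': "coeffs_in A G'" "lead_coeff G' \<notin> Q" "degree G' \<le> degree G"
      "poly G x - poly G' x \<in> Q" using truncate_mod_ideal[OF A I less.prems(1)] by blast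
    have G'x: "poly G' x \<notin> Q" using ideal_diff_iff[OF I G'(4)] less.prems by blast
    have lift: "poly U x * poly G x - c \<in> Q" if "poly U x * poly G' x - c \<in> Q" for U c
    proof -
      have "poly U x * poly G x - c = (poly U x * poly G' x - c) + poly U x * (poly G x - poly G' x)"
        by (simp add: algebra_simps)
      then show ?thesis using that G'(4) ideal_closed(2,3)[OF I] by metis
    qed
    show ?case
    proof (cases "degree G' = 0")
      case True
      then have "poly G' x = lead_coeff G'"
        by (metis degree_0_id mult_zero_right add.right_neutral poly_0 poly_pCons)
      moreover have "lead_coeff G' \<in> A" using G'(1) unfolding coeffs_in_def by blast
      ultimately have "lead_coeff G' \<in> A - Q" "poly [:1:] x * poly G' x - lead_coeff G' \<in> Q"
        using G' ideal_closed(1)[OF I] by auto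
      then show ?thesis using lift cl by blast
    next
      case False
      obtain M H R where *: "coeffs_in A H" "coeffs_in A R" "smult (lead_coeff G' ^ M) F = H * G' + R"
        "R = 0 \<or> degree R < degree G'" "degree H \<le> degree F - degree G'"
        using pseudo_division[OF A G'(1) FA(1)] by blast
      then have R: "degree R < degree G'" using False by auto
      have eq: "lead_coeff G' ^ M * poly F x = poly H x * poly G' x + poly R x"
        using arg_cong[OF *(3), of "\<lambda>p. poly p x"] by simp
      have dH: "degree H < degree F" using *(5) False G'(3) less.prems(3) by linarith
      \<comment> \<open>If the remainder vanished, the quotient \<open>H\<close> would be a relation of lower degree than \<open>F\<close>, hence
      trivial, and then the leading coefficient of \<open>F\<close> would be in \<open>Q\<close>.\<close>
      have "poly R x \<notin> Q"
      proof
        assume Rx: "poly R x \<in> Q"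
        have "poly H x * poly G' x = lead_coeff G' ^ M * poly F x - poly R x" using eq by simp
        also have "\<dots> \<in> Q" using Rx FA by (intro ideal_closed(3,6)[OF I])
        finally have "poly H x \<in> Q" using prime_idealD(3)[OF Q] G'x by blast
        then have HQ: "coeffs_in Q H" using F dH * unfolding minimal_relation_def by blast
        have "lead_coeff G' ^ M * lead_coeff F = coeff (H * G') (degree F) + coeff R (degree F)"
          using arg_cong[OF *(3), of "\<lambda>p. coeff p (degree F)"] by simp
        also have "coeff R (degree F) = 0" using R G'(3) less.prems(3) by (intro coeff_eq_0) linarith
        also have "coeff (H * G') (degree F) + 0 \<in> Q" unfolding coeff_mult add_0_right
          using HQ by (intro ideal_closed(4,7)[OF I]) (auto simp: coeffs_in_def)
        finally show False using prime_idealD(3,4)[OF Q] G'(2) FA(3) by metis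
      qed
      moreover have "degree R < degree G" "degree R < degree F" using R G'(3) less.prems(3) by auto
      ultimately obtain c U where cU: "c \<in> A - Q" "coeffs_in A U" "poly U x * poly R x - c \<in> Q"
        using less.hyps[OF _ *(2)] by blast
      have "poly (0 - U * H) x * poly G' x - c =
          (poly U x * poly R x - c) - (poly U x * lead_coeff G' ^ M) * poly F x"
      proof -
        have "poly R x = lead_coeff G' ^ M * poly F x - poly H x * poly G' x" using eq by simp
        then show ?thesis by (simp only: poly_diff poly_mult) (simp add: algebra_simps)
      qed
      also have "\<dots> \<in> Q" by (rule ideal_closed(6)[OF I cU(3) ideal_closed(3)[OF I FA(2)]])
      finally show ?thesis using lift cU(1) cl(5)[OF cl(1) cl(6)[OF cU(2) *(1)]] by blast
    qed
  qed
  obtain M H R where *: "coeffs_in A H" "coeffs_in A R" "smult (lead_coeff F ^ M) G = H * F + R"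
    "degree R < degree F" using minimal_relation_reduce[OF A Q F G(1)] by blast
  have eq: "lead_coeff F ^ M * poly G x = poly H x * poly F x + poly R x"
    using arg_cong[OF *(3), of "\<lambda>p. poly p x"] by simp
  have "lead_coeff F ^ M * poly G x - poly R x = poly H x * poly F x" using eq by simp
  also have "\<dots> \<in> Q" using FA by (intro ideal_closed(3)[OF I])
  finally have d: "lead_coeff F ^ M * poly G x - poly R x \<in> Q" .
  have "lead_coeff F ^ M * poly G x \<notin> Q" using prime_idealD(3,4)[OF Q] G(2) FA(3) by metis
  then have "poly R x \<notin> Q" using ideal_diff_iff[OF I d] by blast
  then obtain c U where cU: "c \<in> A - Q" "coeffs_in A U" "poly U x * poly R x - c \<in> Q"
    using small[OF *(2) _ *(4)] by blast
  have "poly (smult (lead_coeff F ^ M) U) x * poly G x - c =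
      (poly U x * poly R x - c) + poly U x * (lead_coeff F ^ M * poly G x - poly R x)"
    by (simp add: algebra_simps)
  also have "\<dots> \<in> Q" using cU d by (intro ideal_closed(2,3)[OF I])
  finally have "poly (smult (lead_coeff F ^ M) U) x * poly G x - c \<in> Q" .
  moreover have "coeffs_in A (smult (lead_coeff F ^ M) U)"
    using FA cU(2) by (intro cl) (auto simp: coeffs_in_def)
  ultimately show ?thesis using cU(1) by blast
qed

section \<open>Polynomials in a given set of variables\<close>

definition Const :: "complex \<Rightarrow> ('i, complex) mpoly" where
  "Const c = Poly_Mapping.single 0 c"

definition Var :: "'i \<Rightarrow> ('i, complex) mpoly" where
  "Var i = Poly_Mapping.single (Poly_Mapping.single i 1) 1"

lemma mpoly_eval_simps [simp]:
  "mpoly_eval (Const c) x = c" "mpoly_eval (Var i) x = x $ i"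
  "mpoly_eval (p + q) x = mpoly_eval p x + mpoly_eval q x"
  "mpoly_eval (p * q) x = mpoly_eval p x * mpoly_eval q x"
  by (simp_all add: Const_def Var_def mpoly_eval_single mpoly_eval_add mpoly_eval_mult
      monom_eval_def lookup_single when_def if_distrib[of "\<lambda>n. _ ^ n"] prod.delta cong: if_cong)

lemma mpoly_eval_ring_simps [simp]:
  "mpoly_eval (- p) x = - mpoly_eval p x"
  "mpoly_eval (p - q) x = mpoly_eval p x - mpoly_eval q x"
  "mpoly_eval (p ^ n) x = mpoly_eval p x ^ n"
  "mpoly_eval (prod f J) x = (\<Prod>j\<in>J. mpoly_eval (f j) x)"
proof -
  show u: "mpoly_eval (- p) x = - mpoly_eval p x" for p
    using mpoly_eval_add[of p "- p" x] by (simp add: eq_neg_iff_add_eq_0 add.commute)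
  show "mpoly_eval (p - q) x = mpoly_eval p x - mpoly_eval q x"
    using mpoly_eval_add[of p "- q" x] u[of q] by simp
  show "mpoly_eval (p ^ n) x = mpoly_eval p x ^ n" by (induction n) simp_all
  show "mpoly_eval (prod f J) x = (\<Prod>j\<in>J. mpoly_eval (f j) x)"
    by (induction J rule: infinite_finite_induct) simp_all
qed

lemma mpoly_eval_poly:
  "mpoly_eval (poly F p) x = poly (map_poly (\<lambda>q. mpoly_eval q x) F) (mpoly_eval p x)"
  by (induction F) (simp_all add: map_poly_pCons)

text \<open>The subalgebra \<open>\<complex>[x\<^sub>i | i \<in> T]\<close>. It is given by generators, so that closure properties and
  statements about evaluation follow by rule induction without looking at exponents.\<close>

inductive_set polys :: "'i set \<Rightarrow> ('i, complex) mpoly set" for T where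
  Const: "Const c \<in> polys T"
| Var: "i \<in> T \<Longrightarrow> Var i \<in> polys T"
| add: "p \<in> polys T \<Longrightarrow> q \<in> polys T \<Longrightarrow> p + q \<in> polys T"
| mult: "p \<in> polys T \<Longrightarrow> q \<in> polys T \<Longrightarrow> p * q \<in> polys T"

lemma Const_0: "Const 0 = 0" and Const_1: "Const 1 = 1" and Const_m1: "Const (- 1) = - 1"
  by (simp_all add: Const_def single_uminus)

lemma Const_mult: "Const (c * d) = Const c * Const d"
  by (simp add: Const_def mult_single)

lemma Const_add: "Const (c + d) = Const c + Const d"
  by (simp add: Const_def single_add)

lemma subring_polys: "is_subring (polys T)"
  unfolding is_subring_def
proof (intro conjI ballI)
  show "1 \<in> polys T" using polys.Const[of 1] by (simp add: Const_1)
  fix x y :: "('a, complex) mpoly" assume xy: "x \<in> polys T" "y \<in> polys T"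
  then show "x * y \<in> polys T" by (rule polys.mult)
  have "x + Const (- 1) * y \<in> polys T" by (intro polys.intros xy)
  then show "x - y \<in> polys T" by (simp add: Const_m1)
qed

lemma polys_mono: "S \<subseteq> T \<Longrightarrow> p \<in> polys S \<Longrightarrow> p \<in> polys T"
  by (erule polys.induct) (auto intro: polys.intros)

lemma polys_sum: "(\<And>j. j \<in> J \<Longrightarrow> f j \<in> polys T) \<Longrightarrow> sum f J \<in> polys T"
  by (induction J rule: infinite_finite_induct)
    (auto intro: polys.add subring_closed(1)[OF subring_polys])

lemma polys_prod: "(\<And>j. j \<in> J \<Longrightarrow> f j \<in> polys T) \<Longrightarrow> prod f J \<in> polys T"
  by (induction J rule: infinite_finite_induct)
    (auto intro: polys.mult subring_closed(2)[OF subring_polys])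

lemma polys_power: "p \<in> polys T \<Longrightarrow> p ^ n \<in> polys T"
  by (rule subring_closed(7)[OF subring_polys])

lemma Var_power: "Var i ^ n = Poly_Mapping.single (Poly_Mapping.single i n) 1"
  by (induction n) (simp_all add: Var_def mult_single single_add[symmetric])

lemma monomial_eq_prod_Var:
  "Poly_Mapping.single (a :: 'i::finite \<Rightarrow>\<^sub>0 nat) (1::complex) = (\<Prod>i\<in>UNIV. Var i ^ Poly_Mapping.lookup a i)"
proof -
  have "(\<Prod>i\<in>J. Var i ^ Poly_Mapping.lookup a i) =
      Poly_Mapping.single (\<Sum>i\<in>J. Poly_Mapping.single i (Poly_Mapping.lookup a i)) (1::complex)" for J :: "'i set"
    by (induction J rule: infinite_finite_induct) (simp_all add: Var_power mult_single)
  moreover have "(\<Sum>i\<in>UNIV. Poly_Mapping.single i (Poly_Mapping.lookup a i)) = a"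
    by (rule poly_mapping_eqI) (simp add: lookup_sum lookup_single when_def)
  ultimately show ?thesis by simp
qed

lemma polys_UNIV [simp]: "(p :: ('i::finite, complex) mpoly) \<in> polys UNIV"
proof -
  have "Poly_Mapping.single a c \<in> polys UNIV" for a :: "'i \<Rightarrow>\<^sub>0 nat" and c :: complex
  proof -
    have "Poly_Mapping.single a c = Const c * Poly_Mapping.single a 1"
      by (simp add: Const_def mult_single)
    also have "\<dots> \<in> polys UNIV" unfolding monomial_eq_prod_Var
      by (intro polys.mult polys.Const polys_prod polys_power polys.Var UNIV_I)
    finally show ?thesis .
  qed
  then show ?thesis by (subst mpoly_as_sum) (rule polys_sum)
qed

lemma eval_cong:
  assumes "p \<in> polys T" "\<And>i. i \<in> T \<Longrightarrow> x $ i = y $ i"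
  shows "mpoly_eval p x = mpoly_eval p y"
  using assms by (induction) simp_all

text \<open>Substituting polynomials for the variables gives a polynomial. This is the tool by which functions
  such as \<open>\<beta> \<mapsto> p(x, \<beta>)\<close> for fixed \<open>x\<close> are recognised as polynomial, with control on the
  variables that occur.\<close>

lemma eval_substitute:
  fixes \<phi> :: "complex ^ 'j::finite \<Rightarrow> complex ^ 'i::finite"
  assumes "p \<in> polys T" "\<And>i. i \<in> T \<Longrightarrow> \<exists>q\<in>polys S. \<forall>x. \<phi> x $ i = mpoly_eval q x"
  shows "\<exists>q\<in>polys S. \<forall>x. mpoly_eval p (\<phi> x) = mpoly_eval q x"
  using assms(1)
proof induction
  case (Const c)
  then show ?case by (intro bexI[of _ "Const c"]) (auto intro: polys.intros)
next
  case (Var i)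
  then show ?case using assms(2) by simp
next
  case (add p q)
  then obtain p' q' where "p' \<in> polys S" "q' \<in> polys S" "\<forall>x. mpoly_eval p (\<phi> x) = mpoly_eval p' x"
    "\<forall>x. mpoly_eval q (\<phi> x) = mpoly_eval q' x" by blast
  then show ?case by (intro bexI[of _ "p' + q'"]) (auto intro: polys.intros)
next
  case (mult p q)
  then obtain p' q' where "p' \<in> polys S" "q' \<in> polys S" "\<forall>x. mpoly_eval p (\<phi> x) = mpoly_eval p' x"
    "\<forall>x. mpoly_eval q (\<phi> x) = mpoly_eval q' x" by blast
  then show ?case by (intro bexI[of _ "p' * q'"]) (auto intro: polys.intros)
qed

lemma polys_insert:
  assumes "p \<in> polys (insert j T)"
  shows "\<exists>F. coeffs_in (polys T) F \<and> p = poly F (Var j)"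
  using assms
proof induction
  case (Const c)
  then show ?case using coeffs_in_closed(3)[OF subring_polys polys.Const] by (intro exI[of _ "[:Const c:]"]) simp
next
  case (Var i)
  show ?case
  proof (cases "i = j")
    case True
    have "coeffs_in (polys T) (monom 1 1)"
      by (intro coeffs_in_closed[OF subring_polys] subring_closed(2)[OF subring_polys])
    then show ?thesis using True by (intro exI[of _ "monom 1 1"]) (simp add: poly_monom)
  next
    case False
    then have "coeffs_in (polys T) [:Var i:]"
      using Var by (intro coeffs_in_closed[OF subring_polys] polys.Var) simp
    then show ?thesis by (intro exI[of _ "[:Var i:]"]) simp
  qed
next
  case (add p q)
  then show ?case using coeffs_in_closed(4)[OF subring_polys] by (metis poly_add)
next
  case (mult p q)
  then show ?case using coeffs_in_closed(6)[OF subring_polys] by (metis poly_mult)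
qed

lemma poly_Var_in_polys:
  assumes "coeffs_in (polys T) F"
  shows "poly F (Var j) \<in> polys (insert j T)"
  unfolding poly_altdef
proof (intro polys_sum polys.mult polys_power polys.Var)
  show "coeff F i \<in> polys (insert j T)" for i
    using assms polys_mono[of T "insert j T"] unfolding coeffs_in_def by blast
qed simp

text \<open>Affine space is irreducible. The proof restricts to the line through two points, where
  it is the statement that a product of nonzero univariate polynomials is nonzero. Keeping the line
  visible has a benefit: coordinates in which the two points agree are constant on it, so the common
  nonzero can be kept inside an affine subspace.\<close>

definition line_point :: "complex ^ 'i::finite \<Rightarrow> complex ^ 'i \<Rightarrow> complex \<Rightarrow> complex ^ 'i" where
  "line_point y z t = (\<chi> i. y $ i + t * (z $ i - y $ i))"

lemma eval_on_line: "\<exists>P. \<forall>t. mpoly_eval p (line_point y z t) = poly P t"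
proof -
  have "p \<in> polys UNIV" by simp
  then show ?thesis
  proof induction
    case (Const c)
    show ?case by (rule exI[of _ "[:c:]"]) simp
  next
    case (Var i)
    show ?case by (rule exI[of _ "[:y $ i, z $ i - y $ i:]"]) (simp add: line_point_def)
  next
    case (add p q)
    then obtain P Q where "\<forall>t. mpoly_eval p (line_point y z t) = poly P t"
      "\<forall>t. mpoly_eval q (line_point y z t) = poly Q t" by blast
    then show ?case by (intro exI[of _ "P + Q"]) simp
  next
    case (mult p q)
    then obtain P Q where "\<forall>t. mpoly_eval p (line_point y z t) = poly P t"
      "\<forall>t. mpoly_eval q (line_point y z t) = poly Q t" by blast
    then show ?case by (intro exI[of _ "P * Q"]) simp
  qed
qed

lemma common_nonzero_on_line:
  assumes "mpoly_eval p y \<noteq> 0" "mpoly_eval q z \<noteq> 0"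
  obtains t where "mpoly_eval p (line_point y z t) \<noteq> 0" "mpoly_eval q (line_point y z t) \<noteq> 0"
proof -
  obtain P Q where PQ: "\<And>t. mpoly_eval p (line_point y z t) = poly P t"
    "\<And>t. mpoly_eval q (line_point y z t) = poly Q t" using eval_on_line by metis
  have "line_point y z 0 = y" "line_point y z 1 = z" by (simp_all add: line_point_def vec_eq_iff)
  then have "poly P 0 \<noteq> 0" "poly Q 1 \<noteq> 0" using assms PQ by metis+
  then have "P * Q \<noteq> 0" by auto
  then obtain t where "poly (P * Q) t \<noteq> 0" using poly_all_0_iff_0 by blast
  then show ?thesis using that PQ by auto
qed

lemma eval_prod_nonzero:
  assumes "finite J" "\<And>j. j \<in> J \<Longrightarrow> \<exists>x. mpoly_eval (p j) x \<noteq> 0"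
  shows "\<exists>x. mpoly_eval (prod p J) x \<noteq> 0"
  using assms
proof induction
  case (insert j J)
  then obtain x y where "mpoly_eval (p j) x \<noteq> 0" "mpoly_eval (prod p J) y \<noteq> 0" by blast
  then obtain t where "mpoly_eval (p j) (line_point x y t) \<noteq> 0" "mpoly_eval (prod p J) (line_point x y t) \<noteq> 0"
    by (rule common_nonzero_on_line)
  then show ?case using insert by (intro exI[of _ "line_point x y t"]) auto
qed simp

section \<open>Lifting points, and the Nullstellensatz for prime ideals\<close>

definition update_coord :: "complex ^ 'i::finite \<Rightarrow> 'i \<Rightarrow> complex \<Rightarrow> complex ^ 'i" where
  "update_coord c j \<xi> = (\<chi> i. if i = j then \<xi> else c $ i)"

text \<open>A point \<open>c\<close> at which \<open>Q \<inter> \<complex>[T]\<close> vanishes is a homomorphism from \<open>\<complex>[T]\<close> modulo \<open>Q\<close> to \<open>\<complex>\<close>, and the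
  task is to extend it to \<open>\<complex>[T][x\<^sub>j]\<close>. If \<open>x\<^sub>j\<close> satisfies a minimal relation \<open>F\<close> over \<open>\<complex>[T]\<close>, a root \<open>\<xi>\<close> of \<open>F\<close>
  with coefficients evaluated at \<open>c\<close> is taken: when the leading coefficient of \<open>F\<close> does not vanish at \<open>c\<close>,
  every other relation is, modulo \<open>Q\<close> and up to powers of that coefficient, a multiple of \<open>F\<close>. If \<open>x\<^sub>j\<close> satisfies no relation,
  any \<open>\<xi>\<close> outside a finite set works. The element \<open>a\<close> collects what must not vanish at \<open>c\<close> for this
  to be possible and for \<open>b\<close> to be nonzero at the new point.\<close>

lemma extend_point_one_coordinate:
  assumes Q: "is_prime_ideal Q" and j: "j \<notin> T" and b: "b \<in> polys (insert j T)" "b \<notin> Q"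
  shows "\<exists>a\<in>polys T - Q. \<forall>c. (\<forall>p\<in>Q \<inter> polys T. mpoly_eval p c = 0) \<longrightarrow> mpoly_eval a c \<noteq> 0 \<longrightarrow>
    (\<exists>\<xi>. (\<forall>p\<in>Q \<inter> polys (insert j T). mpoly_eval p (update_coord c j \<xi>) = 0) \<and>
      mpoly_eval b (update_coord c j \<xi>) \<noteq> 0)"
proof -
  note I = prime_idealD(1)[OF Q]
  let ?A = "polys T"
  have ev: "mpoly_eval p (update_coord c j \<xi>) = mpoly_eval p c" if "p \<in> ?A" for p c \<xi>
    using that j by (intro eval_cong[of p T]) (auto simp: update_coord_def)
  have evp: "mpoly_eval (poly K (Var j)) (update_coord c j \<xi>) = poly (map_poly (\<lambda>q. mpoly_eval q c) K) \<xi>"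
    if "coeffs_in ?A K" for K c \<xi>
  proof -
    have "map_poly (\<lambda>q. mpoly_eval q (update_coord c j \<xi>)) K = map_poly (\<lambda>q. mpoly_eval q c) K"
      using that ev by (intro poly_eqI) (simp add: coeff_map_poly coeffs_in_def)
    then show ?thesis by (simp add: mpoly_eval_poly) (simp add: update_coord_def)
  qed
  have ev0: "mpoly_eval (poly K (Var j)) (update_coord c j \<xi>) = 0"
    if "coeffs_in ?A K" "coeffs_in Q K" "\<forall>p\<in>Q \<inter> polys T. mpoly_eval p c = 0" for K c \<xi>
  proof -
    have "map_poly (\<lambda>q. mpoly_eval q c) K = 0"
      using that by (intro poly_eqI) (simp add: coeff_map_poly coeffs_in_def)
    then show ?thesis using evp[OF that(1)] by simp
  qed
  obtain G where G: "coeffs_in ?A G" "b = poly G (Var j)" using polys_insert[OF b(1)] by blast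
  show ?thesis
  proof (cases "\<exists>F. coeffs_in ?A F \<and> poly F (Var j) \<in> Q \<and> \<not> coeffs_in Q F")
    case True
    then obtain F where F: "minimal_relation ?A Q (Var j) F"
      using minimal_relation_exists[OF subring_polys I] by blast
    have FA: "coeffs_in ?A F" "poly F (Var j) \<in> Q" "lead_coeff F \<notin> Q" "lead_coeff F \<in> ?A"
      using F unfolding minimal_relation_def coeffs_in_def by auto
    obtain c0 U where c0: "c0 \<in> ?A" "c0 \<notin> Q" and U: "coeffs_in ?A U" "poly U (Var j) * b - c0 \<in> Q"
      using minimal_relation_inverse[OF subring_polys Q F G(1)] b(2) G(2) by blast
    show ?thesis
    proof (intro bexI[of _ "lead_coeff F * c0"] allI impI)
      show "lead_coeff F * c0 \<in> ?A - Q" using FA c0 prime_idealD(3)[OF Q] by (auto intro: polys.mult)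
      fix c assume c: "\<forall>p\<in>Q \<inter> ?A. mpoly_eval p c = 0" and nz: "mpoly_eval (lead_coeff F * c0) c \<noteq> 0"
      let ?Fc = "map_poly (\<lambda>q. mpoly_eval q c) F"
      \<comment> \<open>Evaluating at \<open>c\<close> keeps the degree of \<open>F\<close>, which is positive, so a root exists.\<close>
      have "coeff ?Fc (degree F) \<noteq> 0" using nz by (simp add: coeff_map_poly)
      then have "degree F \<le> degree ?Fc" by (rule le_degree)
      then have "degree ?Fc > 0" using minimal_relation_degree[OF F] by simp
      then obtain \<xi> where \<xi>: "poly ?Fc \<xi> = 0"
        using fundamental_theorem_of_algebra[of ?Fc] by (auto simp: constant_degree)
      let ?c = "update_coord c j \<xi>"
      have Q0: "mpoly_eval p ?c = 0" if p: "p \<in> Q" "p \<in> polys (insert j T)" for p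
      proof -
        obtain K where K: "coeffs_in ?A K" "p = poly K (Var j)" using polys_insert[OF p(2)] by blast
        obtain M H R where *: "coeffs_in ?A H" "coeffs_in ?A R" "smult (lead_coeff F ^ M) K = H * F + R"
          "degree R < degree F" using minimal_relation_reduce[OF subring_polys Q F K(1)] by blast
        have eq: "lead_coeff F ^ M * p = poly H (Var j) * poly F (Var j) + poly R (Var j)"
          using arg_cong[OF *(3), of "\<lambda>p. poly p (Var j)"] K(2) by simp
        have "poly R (Var j) = lead_coeff F ^ M * p - poly H (Var j) * poly F (Var j)" using eq by simp
        also have "\<dots> \<in> Q"
          by (rule ideal_closed(6)[OF I ideal_closed(3)[OF I p(1)] ideal_closed(3)[OF I FA(2)]])
        finally have "coeffs_in Q R" using F * unfolding minimal_relation_def by blast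
        then have R0: "mpoly_eval (poly R (Var j)) ?c = 0" using ev0[OF *(2) _ c] by blast
        have "mpoly_eval (lead_coeff F) ?c ^ M * mpoly_eval p ?c = 0"
          using arg_cong[OF eq, of "\<lambda>q. mpoly_eval q ?c"] R0 evp[OF FA(1), of c \<xi>] \<xi> by simp
        moreover have "mpoly_eval (lead_coeff F) ?c \<noteq> 0" using ev[OF FA(4)] nz by simp
        ultimately show ?thesis by simp
      qed
      have "poly U (Var j) * b - c0 \<in> polys (insert j T)"
        using poly_Var_in_polys[OF U(1), of j] b(1) polys_mono[of T "insert j T" c0] c0
        by (intro subring_closed[OF subring_polys]) auto
      from Q0[OF U(2) this] have "mpoly_eval (poly U (Var j)) ?c * mpoly_eval b ?c = mpoly_eval c0 ?c" by simp
      moreover have "mpoly_eval c0 ?c \<noteq> 0" using ev[OF c0(1)] nz by simp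
      ultimately have "mpoly_eval b ?c \<noteq> 0" by auto
      then show "\<exists>\<xi>. (\<forall>p\<in>Q \<inter> polys (insert j T). mpoly_eval p (update_coord c j \<xi>) = 0) \<and>
          mpoly_eval b (update_coord c j \<xi>) \<noteq> 0" using Q0 by blast
    qed
  next
    case False
    have "\<not> coeffs_in Q G" using poly_in_ideal[OF I] b(2) G(2) by blast
    then obtain n where n: "coeff G n \<notin> Q" unfolding coeffs_in_def by blast
    show ?thesis
    proof (intro bexI[of _ "coeff G n"] allI impI)
      show "coeff G n \<in> ?A - Q" using n G unfolding coeffs_in_def by blast
      fix c assume c: "\<forall>p\<in>Q \<inter> ?A. mpoly_eval p c = 0" and nz: "mpoly_eval (coeff G n) c \<noteq> 0"
      have "map_poly (\<lambda>q. mpoly_eval q c) G \<noteq> 0" using nz by (metis coeff_0 coeff_map_poly mpoly_eval_0)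
      then obtain \<xi> where "poly (map_poly (\<lambda>q. mpoly_eval q c) G) \<xi> \<noteq> 0" using poly_all_0_iff_0 by blast
      then have "mpoly_eval b (update_coord c j \<xi>) \<noteq> 0" using evp[OF G(1)] G(2) by simp
      moreover have "mpoly_eval p (update_coord c j \<xi>) = 0" if p: "p \<in> Q \<inter> polys (insert j T)" for p
      proof -
        obtain K where K: "coeffs_in ?A K" "p = poly K (Var j)" using polys_insert[of p j T] p by blast
        then have "coeffs_in Q K" using False p by blast
        then show ?thesis using ev0[OF K(1) _ c] K(2) by blast
      qed
      ultimately show "\<exists>\<xi>. (\<forall>p\<in>Q \<inter> polys (insert j T). mpoly_eval p (update_coord c j \<xi>) = 0) \<and>
          mpoly_eval b (update_coord c j \<xi>) \<noteq> 0" by blast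
    qed
  qed
qed

text \<open>The coordinates outside \<open>T\<close> are filled in one after the other. When \<open>T\<close> is independent modulo \<open>Q\<close>,
  the vanishing condition on \<open>c\<close> is void, and the projection of \<open>zero_locus Q\<close> to \<open>\<complex>\<^sup>T\<close> is seen to contain
  a nonempty open set. The induction runs over the complement \<open>D\<close> of \<open>T\<close>.\<close>

lemma extend_point:
  fixes Q :: "('i::finite, complex) mpoly set"
  assumes Q: "is_prime_ideal Q" and b: "b \<notin> Q"
  shows "\<exists>a\<in>polys T - Q. \<forall>c. (\<forall>p\<in>Q \<inter> polys T. mpoly_eval p c = 0) \<longrightarrow> mpoly_eval a c \<noteq> 0 \<longrightarrow>
    (\<exists>c'\<in>zero_locus Q. (\<forall>i\<in>T. c' $ i = c $ i) \<and> mpoly_eval b c' \<noteq> 0)"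
proof -
  have "\<exists>a\<in>polys (- D) - Q. \<forall>c. (\<forall>p\<in>Q \<inter> polys (- D). mpoly_eval p c = 0) \<longrightarrow> mpoly_eval a c \<noteq> 0 \<longrightarrow>
    (\<exists>c'\<in>zero_locus Q. (\<forall>i\<in>- D. c' $ i = c $ i) \<and> mpoly_eval b c' \<noteq> 0)" if "finite D" for D :: "'i set"
    using that
  proof (induction D)
    case empty
    show ?case
    proof (intro bexI[of _ b] allI impI)
      fix c assume "\<forall>p\<in>Q \<inter> polys (- {}). mpoly_eval p c = 0" "mpoly_eval b c \<noteq> 0"
      then show "\<exists>c'\<in>zero_locus Q. (\<forall>i\<in>- {}. c' $ i = c $ i) \<and> mpoly_eval b c' \<noteq> 0"
        by (intro bexI[of _ c]) (auto simp: zero_locus_def)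
    qed (use b in simp)
  next
    case (insert j D)
    then obtain a1 where a1: "a1 \<in> polys (- D)" "a1 \<notin> Q"
      and l1: "\<And>c. (\<forall>p\<in>Q \<inter> polys (- D). mpoly_eval p c = 0) \<Longrightarrow> mpoly_eval a1 c \<noteq> 0 \<Longrightarrow>
        (\<exists>c'\<in>zero_locus Q. (\<forall>i\<in>- D. c' $ i = c $ i) \<and> mpoly_eval b c' \<noteq> 0)" by blast
    have D: "insert j (- insert j D) = - D" using insert.hyps by auto
    obtain a where a: "a \<in> polys (- insert j D) - Q"
      and l: "\<And>c. (\<forall>p\<in>Q \<inter> polys (- insert j D). mpoly_eval p c = 0) \<Longrightarrow> mpoly_eval a c \<noteq> 0 \<Longrightarrow>
        (\<exists>\<xi>. (\<forall>p\<in>Q \<inter> polys (- D). mpoly_eval p (update_coord c j \<xi>) = 0) \<and>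
          mpoly_eval a1 (update_coord c j \<xi>) \<noteq> 0)"
      using extend_point_one_coordinate[OF Q, of j "- insert j D" a1] a1 unfolding D by auto
    show ?case
    proof (intro bexI[OF _ a] allI impI)
      fix c assume "\<forall>p\<in>Q \<inter> polys (- insert j D). mpoly_eval p c = 0" "mpoly_eval a c \<noteq> 0"
      then obtain \<xi> where "\<forall>p\<in>Q \<inter> polys (- D). mpoly_eval p (update_coord c j \<xi>) = 0"
        "mpoly_eval a1 (update_coord c j \<xi>) \<noteq> 0" using l by blast
      then obtain c' where c': "c' \<in> zero_locus Q" "\<forall>i\<in>- D. c' $ i = update_coord c j \<xi> $ i"
        "mpoly_eval b c' \<noteq> 0" using l1 by blast
      have "\<forall>i\<in>- insert j D. c' $ i = c $ i" using c'(2) by (auto simp: update_coord_def)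
      then show "\<exists>c'\<in>zero_locus Q. (\<forall>i\<in>- insert j D. c' $ i = c $ i) \<and> mpoly_eval b c' \<noteq> 0"
        using c' by blast
    qed
  qed
  from this[of "- T"] show ?thesis by simp
qed

definition vanishing_ideal :: "(complex ^ 'i::finite) set \<Rightarrow> ('i, complex) mpoly set" where
  "vanishing_ideal V = {p. \<forall>x\<in>V. mpoly_eval p x = 0}"

lemma vanishing_ideal_is_ideal: "is_ideal (vanishing_ideal V)"
  by (simp add: is_ideal_def vanishing_ideal_def)

lemma zero_locus_vanishing_ideal:
  assumes "closedin zariski V"
  shows "zero_locus (vanishing_ideal V) = V"
  using assms unfolding closedin_zariski zero_locus_def vanishing_ideal_def by auto

lemma closedin_zero_locus [simp]: "closedin zariski (zero_locus P)"
  unfolding closedin_zariski by blast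

lemma constants_prime:
  assumes "is_prime_ideal Q" "p \<in> polys {}" "p \<in> Q"
  shows "mpoly_eval p x = 0"
proof -
  have "\<exists>c. p = Const c" using assms(2)
    by induction (auto simp: Const_add[symmetric] Const_mult[symmetric])
  then obtain c where c: "p = Const c" by blast
  have "c = 0"
  proof (rule ccontr)
    assume "c \<noteq> 0"
    then have "Const (1 / c) * p = 1" by (simp add: c Const_mult[symmetric] Const_1)
    then show False using ideal_closed(3)[OF prime_idealD(1)[OF assms(1)] assms(3)] prime_idealD(2)[OF assms(1)]
      by metis
  qed
  then show ?thesis by (simp add: c)
qed

text \<open>The case \<open>T = {}\<close> of \<open>extend_point\<close>: the element \<open>a\<close> is then a nonzero constant, so every \<open>b\<close> outside
  \<open>Q\<close> is nonzero at some zero of \<open>Q\<close>.\<close>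

lemma nullstellensatz_prime:
  fixes Q :: "('i::finite, complex) mpoly set"
  assumes Q: "is_prime_ideal Q"
  shows "vanishing_ideal (zero_locus Q) = Q"
proof
  show "Q \<subseteq> vanishing_ideal (zero_locus Q)" unfolding vanishing_ideal_def zero_locus_def by blast
  show "vanishing_ideal (zero_locus Q) \<subseteq> Q"
  proof (rule subsetI, rule ccontr)
    fix b assume b: "b \<in> vanishing_ideal (zero_locus Q)" "b \<notin> Q"
    obtain a where a: "a \<in> polys {}" "a \<notin> Q" "\<And>c. (\<forall>p\<in>Q \<inter> polys {}. mpoly_eval p c = 0) \<Longrightarrow>
        mpoly_eval a c \<noteq> 0 \<Longrightarrow> \<exists>c'\<in>zero_locus Q. mpoly_eval b c' \<noteq> 0"
      using extend_point[OF Q b(2), of "{}"] by blast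
    have "\<exists>c. mpoly_eval a c \<noteq> 0"
    proof -
      have "\<exists>c. a = Const c" using a(1)
        by induction (auto simp: Const_add[symmetric] Const_mult[symmetric])
      then obtain c where "a = Const c" by blast
      moreover have "c \<noteq> 0" using a(2) \<open>a = Const c\<close> ideal_closed(1)[OF prime_idealD(1)[OF Q]] Const_0 by metis
      ultimately show ?thesis by simp
    qed
    then obtain c where "mpoly_eval a c \<noteq> 0" by blast
    then obtain c' where "c' \<in> zero_locus Q" "mpoly_eval b c' \<noteq> 0"
      using a(3)[of c] constants_prime[OF Q] by blast
    then show False using b(1) unfolding vanishing_ideal_def by blast
  qed
qed

lemma irreducible_zero_locus:
  assumes Q: "is_prime_ideal (Q :: ('i::finite, complex) mpoly set)"
  shows "irreducible_in zariski (zero_locus Q)"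
  unfolding irreducible_in_def
proof (intro conjI allI impI)
  let ?Z = "zero_locus Q"
  show "?Z \<noteq> {}"
    using nullstellensatz_prime[OF Q] prime_idealD(2)[OF Q] unfolding vanishing_ideal_def by auto
  fix A B assume AB: "closedin (subtopology zariski ?Z) A" "closedin (subtopology zariski ?Z) B" "?Z = A \<union> B"
  then have cl: "closedin zariski A" "closedin zariski B"
    using closedin_trans_full closedin_zero_locus by blast+
  show "A = ?Z \<or> B = ?Z"
  proof (rule ccontr)
    assume n: "\<not> ?thesis"
    have "\<exists>p. (\<forall>x\<in>Y. mpoly_eval p x = 0) \<and> p \<notin> Q" if "closedin zariski Y" "Y \<subset> ?Z" for Y
    proof (rule ccontr)
      assume "\<not> ?thesis"
      then have "vanishing_ideal Y \<subseteq> Q" unfolding vanishing_ideal_def by blast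
      then have "?Z \<subseteq> zero_locus (vanishing_ideal Y)" unfolding zero_locus_def by blast
      then show False using zero_locus_vanishing_ideal[OF that(1)] that(2) by blast
    qed
    moreover have "A \<subset> ?Z" "B \<subset> ?Z" using n AB(3) by auto
    ultimately obtain p q where "\<forall>x\<in>A. mpoly_eval p x = 0" "p \<notin> Q" "\<forall>x\<in>B. mpoly_eval q x = 0" "q \<notin> Q"
      using cl by metis
    moreover from this have "p * q \<in> vanishing_ideal ?Z" using AB(3) unfolding vanishing_ideal_def by auto
    ultimately show False using nullstellensatz_prime[OF Q] prime_idealD(3)[OF Q] by blast
  qed
qed simp

lemma prime_vanishing_ideal:
  assumes Z: "closedin zariski Z" "irreducible_in zariski Z"
  shows "is_prime_ideal (vanishing_ideal Z)"
  unfolding is_prime_ideal_def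
proof (intro conjI allI impI)
  have "Z \<noteq> {}" using Z(2) unfolding irreducible_in_def by blast
  then show "1 \<notin> vanishing_ideal Z" unfolding vanishing_ideal_def by auto
  fix p q assume pq: "p * q \<in> vanishing_ideal Z"
  have cl: "closedin (subtopology zariski Z) (Z \<inter> zero_locus {r})" for r
    using closedin_Int[OF Z(1) closedin_zero_locus]
    by (subst closedin_closed_subtopology[OF Z(1)]) auto
  have "Z = (Z \<inter> zero_locus {p}) \<union> (Z \<inter> zero_locus {q})"
    using pq unfolding vanishing_ideal_def zero_locus_def by auto
  then have "Z \<inter> zero_locus {p} = Z \<or> Z \<inter> zero_locus {q} = Z"
    using Z(2) cl unfolding irreducible_in_def by metis
  then show "p \<in> vanishing_ideal Z \<or> q \<in> vanishing_ideal Z"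
    unfolding vanishing_ideal_def zero_locus_def by auto
qed (rule vanishing_ideal_is_ideal)

section \<open>Independent coordinates give chains of irreducible sets\<close>

definition indep_mod :: "'i::finite set \<Rightarrow> ('i, complex) mpoly set \<Rightarrow> bool" where
  "indep_mod T I \<longleftrightarrow> (\<forall>p\<in>polys T \<inter> I. \<forall>x. mpoly_eval p x = 0)"

text \<open>For closed \<open>V\<close> these are the chains in the definition of the Krull dimension of \<open>V\<close>, with
  the closedness stated in the ambient space.\<close>

definition has_chain :: "(complex ^ 'i::finite) set \<Rightarrow> nat \<Rightarrow> bool" where
  "has_chain V d \<longleftrightarrow> (\<exists>Z. (\<forall>i\<le>d. closedin zariski (Z i) \<and> irreducible_in zariski (Z i) \<and> Z i \<subseteq> V) \<and>
     (\<forall>i<d. Z i \<subset> Z (Suc i)))"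

lemma krull_dim_eq_chain:
  assumes "closedin zariski V"
  shows "krull_dim zariski V = Sup {ereal (real d) | d. has_chain V d}"
  unfolding krull_dim_def has_chain_def closedin_closed_subtopology[OF assms]
  by (simp add: conj_commute conj_left_commute)

lemma has_chain_append:
  assumes "has_chain V' d" "V' \<subset> Z" "Z \<subseteq> V" "closedin zariski Z" "irreducible_in zariski Z"
  shows "has_chain V (Suc d)"
proof -
  obtain Y where Y: "\<And>i. i \<le> d \<Longrightarrow> closedin zariski (Y i)" "\<And>i. i \<le> d \<Longrightarrow> irreducible_in zariski (Y i)"
    "\<And>i. i \<le> d \<Longrightarrow> Y i \<subseteq> V'" "\<And>i. i < d \<Longrightarrow> Y i \<subset> Y (Suc i)"
    using assms(1) unfolding has_chain_def by metis
  define Y' where "Y' i = (if i \<le> d then Y i else Z)" for i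
  have "closedin zariski (Y' i) \<and> irreducible_in zariski (Y' i) \<and> Y' i \<subseteq> V" for i
    using Y(1-3)[of i] assms unfolding Y'_def by auto
  moreover have "Y' i \<subset> Y' (Suc i)" if "i < Suc d" for i
  proof (cases "i = d")
    case True then show ?thesis using Y(3)[of d] assms(2) unfolding Y'_def by auto
  next
    case False then show ?thesis using Y(4)[of i] that unfolding Y'_def by auto
  qed
  ultimately show ?thesis unfolding has_chain_def by blast
qed

text \<open>Geometrically: a closed set with dense image in \<open>\<complex>\<^sup>T\<close> has an irreducible closed subset with dense
  image. It is cut out by a prime ideal that avoids the nonzero polynomials in \<open>T\<close>.\<close>

lemma indep_prime_above:
  fixes I :: "('i::finite, complex) mpoly set"
  assumes "is_ideal I" "indep_mod T I"
  obtains Q where "is_prime_ideal Q" "I \<subseteq> Q" "indep_mod T Q"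
proof -
  define S :: "('i, complex) mpoly set" where "S = {p \<in> polys T. \<exists>x. mpoly_eval p x \<noteq> 0}"
  have S1: "1 \<in> S" unfolding S_def using subring_closed(2)[OF subring_polys] by auto
  have Sm: "p * q \<in> S" if pq: "p \<in> S" "q \<in> S" for p q
  proof -
    obtain y z where yz: "mpoly_eval p y \<noteq> 0" "mpoly_eval q z \<noteq> 0" using pq unfolding S_def by blast
    obtain t where "mpoly_eval p (line_point y z t) \<noteq> 0" "mpoly_eval q (line_point y z t) \<noteq> 0"
      by (rule common_nonzero_on_line[OF yz])
    then have "mpoly_eval (p * q) (line_point y z t) \<noteq> 0" by simp
    then show ?thesis using pq unfolding S_def by (blast intro: polys.mult)
  qed
  have "I \<inter> S = {}" using assms(2) unfolding S_def indep_mod_def by blast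
  from prime_ideal_avoiding[OF assms(1) S1 Sm this] obtain Q
    where Q: "is_prime_ideal Q" "I \<subseteq> Q" "Q \<inter> S = {}" by blast
  have "indep_mod T Q" unfolding indep_mod_def
  proof (intro ballI allI, rule ccontr)
    fix p x assume "p \<in> polys T \<inter> Q" "mpoly_eval p x \<noteq> 0"
    then have "p \<in> Q \<inter> S" unfolding S_def by blast
    then show False using Q(3) by blast
  qed
  then show ?thesis using that Q by blast
qed

text \<open>Induction on \<open>T\<close>. Replace \<open>V\<close> by an irreducible closed subset \<open>Z\<close> on which \<open>T \<union> {j}\<close> is still
  independent. By \<open>extend_point\<close> the image of \<open>Z\<close> in \<open>\<complex>\<^bsup>T \<union> {j}\<^esup>\<close> contains the points where some \<open>a\<close> is
  nonzero. If \<open>a\<close> is nonzero at a point with \<open>j\<close>-th coordinate \<open>\<xi>\<close>, the slice \<open>x\<^sub>j = \<xi>\<close> of \<open>Z\<close> therefore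
  has dense image in \<open>\<complex>\<^sup>T\<close>. The slice is a proper subset of \<open>Z\<close>, so \<open>Z\<close> can be put on top of a
  chain in it.\<close>

lemma has_chain_of_indep:
  fixes V :: "(complex ^ 'i::finite) set"
  assumes "closedin zariski V" "indep_mod T (vanishing_ideal V)"
  shows "has_chain V (card T)"
proof -
  have "finite T" by simp
  then show ?thesis using assms
  proof (induction T arbitrary: V)
    case (empty V)
    obtain Q where Q: "is_prime_ideal Q" "vanishing_ideal V \<subseteq> Q"
      using indep_prime_above[OF vanishing_ideal_is_ideal empty(2)] by blast
    have "zero_locus Q \<subseteq> V"
      using Q(2) zero_locus_vanishing_ideal[OF empty(1)] unfolding zero_locus_def by blast
    then show ?case using irreducible_zero_locus[OF Q(1)] unfolding has_chain_def
      by (intro exI[of _ "\<lambda>_. zero_locus Q"]) simp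
  next
    case (insert j T V)
    obtain Q where Q: "is_prime_ideal Q" "vanishing_ideal V \<subseteq> Q" and ind: "indep_mod (insert j T) Q"
      using indep_prime_above[OF vanishing_ideal_is_ideal insert.prems(2)] by blast
    let ?Z = "zero_locus Q"
    have ZV: "?Z \<subseteq> V"
      using Q(2) zero_locus_vanishing_ideal[OF insert.prems(1)] unfolding zero_locus_def by blast
    obtain a where a: "a \<in> polys (insert j T)" "a \<notin> Q"
      and lift: "\<And>c. mpoly_eval a c \<noteq> 0 \<Longrightarrow> \<exists>c'\<in>?Z. \<forall>i\<in>insert j T. c' $ i = c $ i"
      using extend_point[OF Q(1) prime_idealD(2)[OF Q(1)], of "insert j T"] ind
      unfolding indep_mod_def by blast
    have "a \<notin> vanishing_ideal ?Z" using a(2) nullstellensatz_prime[OF Q(1)] by blast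
    then obtain c where c: "mpoly_eval a c \<noteq> 0" unfolding vanishing_ideal_def by blast
    define h where "h = Var j - Const (c $ j)"
    define V' where "V' = ?Z \<inter> zero_locus {h}"
    have V'_iff: "x \<in> V' \<longleftrightarrow> x \<in> ?Z \<and> x $ j = c $ j" for x
      unfolding V'_def h_def by (simp add: zero_locus_def)
    have cl: "closedin zariski V'" unfolding V'_def by (intro closedin_Int closedin_zero_locus)
    have "indep_mod T (vanishing_ideal V')"
      unfolding indep_mod_def
    proof (intro ballI allI, rule ccontr)
      fix p y assume p: "p \<in> polys T \<inter> vanishing_ideal V'" and y: "mpoly_eval p y \<noteq> 0"
      \<comment> \<open>Both ends of the line from \<open>?y\<close> to \<open>c\<close> have the same \<open>j\<close>-th coordinate, so all of it lies over the slice.\<close>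
      let ?y = "update_coord y j (c $ j)"
      have "mpoly_eval p ?y = mpoly_eval p y"
        using p insert.hyps by (intro eval_cong[of p T]) (auto simp: update_coord_def)
      then have "mpoly_eval p ?y \<noteq> 0" using y by simp
      from common_nonzero_on_line[OF this c] obtain t where
        t: "mpoly_eval p (line_point ?y c t) \<noteq> 0" "mpoly_eval a (line_point ?y c t) \<noteq> 0" by blast
      obtain c' where c': "c' \<in> ?Z" "\<forall>i\<in>insert j T. c' $ i = line_point ?y c t $ i" using lift[OF t(2)] by blast
      have "c' \<in> V'" using c' unfolding V'_iff by (simp add: line_point_def update_coord_def)
      moreover have "mpoly_eval p c' = mpoly_eval p (line_point ?y c t)"
        using p c' by (intro eval_cong[of p T]) auto
      ultimately show False using t(1) p unfolding vanishing_ideal_def by auto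
    qed
    from insert.IH[OF cl this] have ch: "has_chain V' (card T)" .
    have "V' \<subset> ?Z"
    proof -
      have hp: "h \<in> polys (insert j T)" unfolding h_def
        by (intro subring_closed(3)[OF subring_polys] polys.Var polys.Const) simp
      have "mpoly_eval h (update_coord c j (c $ j + 1)) \<noteq> 0" by (simp add: h_def update_coord_def)
      then have "h \<notin> Q" using hp ind unfolding indep_mod_def by blast
      then have "h \<notin> vanishing_ideal ?Z" using nullstellensatz_prime[OF Q(1)] by blast
      then obtain x where "x \<in> ?Z" "mpoly_eval h x \<noteq> 0" unfolding vanishing_ideal_def by blast
      then show ?thesis unfolding V'_def zero_locus_def by blast
    qed
    from has_chain_append[OF ch this ZV closedin_zero_locus irreducible_zero_locus[OF Q(1)]]
    show ?case using insert.hyps by simp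
  qed
qed

section \<open>Maximal independent sets of coordinates bound the length of chains\<close>

lemma vector_space_mpoly: "vector_space (\<lambda>c (p :: ('i, complex) mpoly). Const c * p)"
  by unfold_locales (simp_all add: algebra_simps Const_mult Const_add Const_1)

interpretation mp: vector_space "\<lambda>c (p :: ('i, complex) mpoly). Const c * p"
  by (rule vector_space_mpoly)

lemma linear_dependence_mod:
  fixes v :: "'b \<Rightarrow> ('i, complex) mpoly"
  assumes Q: "is_ideal Q" and I: "finite I" and B: "finite B" "card B < card I"
    and v: "\<And>b. b \<in> I \<Longrightarrow> v b \<in> mp.span (B \<union> Q)"
  shows "\<exists>r. (\<exists>b\<in>I. r b \<noteq> 0) \<and> (\<Sum>b\<in>I. Const (r b) * v b) \<in> Q"
proof -
  have "mp.subspace Q" unfolding mp.subspace_def using ideal_closed[OF Q] by blast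
  then have spQ: "mp.span Q = Q" by (rule mp.span_eq_iff[THEN iffD2])
  have "\<exists>w. w \<in> mp.span B \<and> v b - w \<in> Q" if bI: "b \<in> I" for b
  proof -
    obtain x y where "x \<in> mp.span B" "y \<in> Q" "v b = x + y"
      using v[OF bI] unfolding mp.span_Un spQ by blast
    then show ?thesis by (intro exI[of _ x]) simp
  qed
  then obtain w where w: "\<And>b. b \<in> I \<Longrightarrow> w b \<in> mp.span B" "\<And>b. b \<in> I \<Longrightarrow> v b - w b \<in> Q" by metis
  have "\<exists>r. (\<exists>b\<in>I. r b \<noteq> 0) \<and> (\<Sum>b\<in>I. Const (r b) * w b) = 0"
  proof (cases "inj_on w I")
    case True
    have "mp.dependent (w ` I)"
    proof (rule ccontr)
      assume "mp.independent (w ` I)"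
      then have "card (w ` I) \<le> card B"
        using mp.independent_span_bound[OF B(1)] w(1) by blast
      then show False using B(2) card_image[OF True] by simp
    qed
    then obtain u where u: "\<exists>x\<in>w ` I. u x \<noteq> 0" "(\<Sum>x\<in>w ` I. Const (u x) * x) = 0"
      using mp.dependent_finite[of "w ` I"] I by blast
    then show ?thesis using True by (intro exI[of _ "\<lambda>b. u (w b)"]) (auto simp: sum.reindex)
  next
    case False
    then obtain b1 b2 where b: "b1 \<in> I" "b2 \<in> I" "b1 \<noteq> b2" "w b1 = w b2" unfolding inj_on_def by blast
    define r where "r b = (if b = b1 then 1 else if b = b2 then - 1 else (0::complex))" for b
    have "(\<Sum>b\<in>I. Const (r b) * w b) = (\<Sum>b\<in>{b1, b2}. Const (r b) * w b)"
      using I b by (intro sum.mono_neutral_right) (auto simp: r_def Const_0)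
    also have "\<dots> = 0" using b by (simp add: r_def Const_1 Const_m1)
    finally show ?thesis using b by (intro exI[of _ r]) (auto simp: r_def intro!: bexI[of _ b1])
  qed
  then obtain r where l: "\<exists>b\<in>I. r b \<noteq> 0" "(\<Sum>b\<in>I. Const (r b) * w b) = 0" by blast
  have "(\<Sum>b\<in>I. Const (r b) * v b) = (\<Sum>b\<in>I. Const (r b) * (v b - w b))"
    using l(2) by (simp add: right_diff_distrib sum_subtractf)
  also have "\<dots> \<in> Q" by (intro ideal_closed(7)[OF Q] ideal_closed(3)[OF Q] w)
  finally show ?thesis using l(1) by blast
qed

text \<open>The coordinates outside \<open>T\<close> are algebraic over \<open>\<complex>[T]\<close> modulo \<open>Q\<close>, the coordinate \<open>j\<close> by the relation \<open>F j\<close>.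
  The plan is to bound the growth of the polynomial ring modulo \<open>Q\<close>: reducing powers of these
  coordinates with the relations leaves only monomials with bounded exponents outside \<open>T\<close>.\<close>

locale algebraic_over =
  fixes T :: "'i::finite set" and Q :: "('i, complex) mpoly set" and F :: "'i \<Rightarrow> ('i, complex) mpoly poly"
  assumes Q: "is_prime_ideal Q"
    and F_coeffs: "j \<notin> T \<Longrightarrow> coeffs_in (polys T) (F j)"
    and F_rel: "j \<notin> T \<Longrightarrow> poly (F j) (Var j) \<in> Q"
    and F_lead: "j \<notin> T \<Longrightarrow> lead_coeff (F j) \<notin> Q"
    and F_deg: "j \<notin> T \<Longrightarrow> 0 < degree (F j)"
begin

definition reduced_monomials :: "nat \<Rightarrow> ('i, complex) mpoly set" where
  "reduced_monomials u = (\<lambda>e. Poly_Mapping.single e 1) ` {e. (\<forall>i\<in>T. Poly_Mapping.lookup e i \<le> u) \<and>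
     (\<forall>i. i \<notin> T \<longrightarrow> Poly_Mapping.lookup e i < degree (F i))}"

definition reduced_span :: "nat \<Rightarrow> ('i, complex) mpoly set" where
  "reduced_span u = mp.span (reduced_monomials u \<union> Q)"

text \<open>Multiplication by \<open>p\<close> raises the bound on the \<open>T\<close>-exponents by a constant only. A polynomial need not be
  tame, since reducing \<open>x\<^sub>j\<close> requires a division by the leading coefficient of \<open>F j\<close>. The tame
  ones form a subalgebra, and every polynomial becomes tame after multiplication by a power of
  \<open>denom\<close>, the product of these leading coefficients (\<open>tame_denom_power\<close>).\<close>

definition tame :: "('i, complex) mpoly \<Rightarrow> bool" where
  "tame p \<longleftrightarrow> (\<exists>\<kappa>. \<forall>u. \<forall>w\<in>reduced_span u. p * w \<in> reduced_span (u + \<kappa>))"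

lemma card_reduced_monomials: "finite (reduced_monomials u)" "card (reduced_monomials u) \<le> (u + 1) ^ card T * (\<Prod>i\<in>- T. degree (F i))"
proof -
  let ?X = "{e. (\<forall>i\<in>T. Poly_Mapping.lookup e i \<le> u) \<and> (\<forall>i. i \<notin> T \<longrightarrow> Poly_Mapping.lookup e i < degree (F i))}"
  let ?P = "Pi\<^sub>E UNIV (\<lambda>i. if i \<in> T then {..u} else {..<degree (F i)})"
  have inj: "inj_on Poly_Mapping.lookup ?X" by (rule inj_onI) (simp add: poly_mapping_eqI)
  have sub: "Poly_Mapping.lookup ` ?X \<subseteq> ?P" by (auto simp: PiE_iff)
  have fin: "finite ?P" by (intro finite_PiE) auto
  have finX: "finite ?X" using finite_imageD[OF finite_subset[OF sub fin] inj] .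
  then show "finite (reduced_monomials u)" unfolding reduced_monomials_def by simp
  have "card (reduced_monomials u) \<le> card ?X" unfolding reduced_monomials_def by (rule card_image_le[OF finX])
  also have "\<dots> = card (Poly_Mapping.lookup ` ?X)" by (rule card_image[OF inj, symmetric])
  also have "\<dots> \<le> card ?P" by (rule card_mono[OF fin sub])
  also have "\<dots> = (\<Prod>i\<in>UNIV. if i \<in> T then u + 1 else degree (F i))"
    by (subst card_PiE) (auto intro!: prod.cong)
  also have "\<dots> = (\<Prod>i\<in>T. u + 1) * (\<Prod>i\<in>- T. degree (F i))"
    by (subst prod.If_cases) (auto simp: Compl_eq)
  finally show "card (reduced_monomials u) \<le> (u + 1) ^ card T * (\<Prod>i\<in>- T. degree (F i))" by simp
qed

lemma reduced_span_closed: "0 \<in> reduced_span u" "x \<in> reduced_span u \<Longrightarrow> y \<in> reduced_span u \<Longrightarrow> x + y \<in> reduced_span u" "x \<in> reduced_span u \<Longrightarrow> Const c * x \<in> reduced_span u"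
  "x \<in> reduced_span u \<Longrightarrow> y \<in> reduced_span u \<Longrightarrow> x - y \<in> reduced_span u" "(\<And>k. k \<in> K \<Longrightarrow> f k \<in> reduced_span u) \<Longrightarrow> sum f K \<in> reduced_span u"
  "x \<in> reduced_monomials u \<Longrightarrow> x \<in> reduced_span u" "x \<in> Q \<Longrightarrow> x \<in> reduced_span u"
  unfolding reduced_span_def by (auto intro: mp.span_zero mp.span_add mp.span_scale mp.span_diff mp.span_sum mp.span_base)

lemma reduced_span_mono: "u \<le> u' \<Longrightarrow> w \<in> reduced_span u \<Longrightarrow> w \<in> reduced_span u'"
proof -
  assume u: "u \<le> u'"
  have "reduced_monomials u \<subseteq> reduced_monomials u'" unfolding reduced_monomials_def by (intro image_mono) (use u in \<open>auto intro: order_trans\<close>)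
  then show "w \<in> reduced_span u \<Longrightarrow> w \<in> reduced_span u'" unfolding reduced_span_def using mp.span_mono[of "reduced_monomials u \<union> Q" "reduced_monomials u' \<union> Q"] by blast
qed

lemma reduced_span_mult_generators:
  assumes "\<And>b. b \<in> reduced_monomials u \<Longrightarrow> p * b \<in> reduced_span u'" "w \<in> reduced_span u"
  shows "p * w \<in> reduced_span u'"
proof -
  have "mp.subspace {x. p * x \<in> reduced_span u'}"
    unfolding mp.subspace_def using reduced_span_closed(1)[of u'] reduced_span_closed(2)[of _ u'] reduced_span_closed(3)[of _ u']
    by (auto simp: distrib_left mult.left_commute[of p])
  moreover have "reduced_monomials u \<union> Q \<subseteq> {x. p * x \<in> reduced_span u'}"
    using assms(1) reduced_span_closed(7) ideal_closed(3)[OF prime_idealD(1)[OF Q]] by blast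
  ultimately have "reduced_span u \<subseteq> {x. p * x \<in> reduced_span u'}" unfolding reduced_span_def[of u] by (intro mp.span_minimal)
  then show ?thesis using assms(2) by blast
qed

lemma tame_Const: "tame (Const c)"
  unfolding tame_def using reduced_span_closed(3) by (intro exI[of _ 0]) simp

lemma tame_add:
  assumes "tame p" "tame q" shows "tame (p + q)"
proof -
  obtain \<kappa> \<kappa>' where k: "\<And>u w. w \<in> reduced_span u \<Longrightarrow> p * w \<in> reduced_span (u + \<kappa>)" "\<And>u w. w \<in> reduced_span u \<Longrightarrow> q * w \<in> reduced_span (u + \<kappa>')"
    using assms unfolding tame_def by blast
  have "(p + q) * w \<in> reduced_span (u + (\<kappa> + \<kappa>'))" if "w \<in> reduced_span u" for u w
    unfolding distrib_right
    by (rule reduced_span_closed(2)) (rule reduced_span_mono[OF _ k(1)[OF that]] reduced_span_mono[OF _ k(2)[OF that]], simp)+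
  then show ?thesis unfolding tame_def by blast
qed

lemma tame_mult:
  assumes "tame p" "tame q" shows "tame (p * q)"
proof -
  obtain \<kappa> \<kappa>' where k: "\<And>u w. w \<in> reduced_span u \<Longrightarrow> p * w \<in> reduced_span (u + \<kappa>)" "\<And>u w. w \<in> reduced_span u \<Longrightarrow> q * w \<in> reduced_span (u + \<kappa>')"
    using assms unfolding tame_def by blast
  have "(p * q) * w \<in> reduced_span (u + (\<kappa>' + \<kappa>))" if "w \<in> reduced_span u" for u w
    using k(1)[OF k(2)[OF that]] by (simp add: mult.assoc add.assoc)
  then show ?thesis unfolding tame_def by blast
qed

lemma tame_prod: "(\<And>j. j \<in> J \<Longrightarrow> tame (f j)) \<Longrightarrow> tame (prod f J)"
  using tame_Const[of 1] by (induction J rule: infinite_finite_induct) (auto simp: Const_1 intro: tame_mult)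

lemma tame_power: "tame p \<Longrightarrow> tame (p ^ n)"
  using tame_Const[of 1] by (induction n) (auto simp: Const_1 intro: tame_mult)

lemma Var_mult_monomial: "Var j * Poly_Mapping.single e 1 = Poly_Mapping.single (Poly_Mapping.single j 1 + e) 1"
  by (simp add: Var_def mult_single)

lemma tame_Var: assumes "j \<in> T" shows "tame (Var j)"
  unfolding tame_def
proof (intro exI[of _ 1] allI ballI)
  fix u w assume "w \<in> reduced_span u"
  then show "Var j * w \<in> reduced_span (u + 1)"
  proof (rule reduced_span_mult_generators[rotated])
    fix b assume "b \<in> reduced_monomials u"
    then have "Var j * b \<in> reduced_monomials (u + 1)" using assms
      unfolding reduced_monomials_def by (force simp: Var_mult_monomial lookup_add lookup_single when_def le_Suc_eq)
    then show "Var j * b \<in> reduced_span (u + 1)" by (rule reduced_span_closed(6))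
  qed
qed

lemma tame_polys: "p \<in> polys T \<Longrightarrow> tame p"
  by (induction rule: polys.induct) (auto intro: tame_Const tame_Var tame_add tame_mult)

lemma tame_common:
  assumes "finite J" "\<And>j. j \<in> J \<Longrightarrow> tame (f j)"
  shows "\<exists>\<kappa>. \<forall>j\<in>J. \<forall>u. \<forall>w\<in>reduced_span u. f j * w \<in> reduced_span (u + \<kappa>)"
  using assms
proof (induction J)
  case (insert j J)
  obtain \<kappa> where k: "\<forall>j\<in>J. \<forall>u. \<forall>w\<in>reduced_span u. f j * w \<in> reduced_span (u + \<kappa>)" using insert by blast
  obtain \<kappa>' where k': "\<forall>u. \<forall>w\<in>reduced_span u. f j * w \<in> reduced_span (u + \<kappa>')" using insert.prems unfolding tame_def by blast
  have "f i * w \<in> reduced_span (u + (\<kappa> + \<kappa>'))" if "i \<in> insert j J" "w \<in> reduced_span u" for i u w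
    using that k k' reduced_span_mono[of "u + \<kappa>" "u + (\<kappa> + \<kappa>')"] reduced_span_mono[of "u + \<kappa>'" "u + (\<kappa> + \<kappa>')"] by fastforce
  then show ?case by blast
qed simp

text \<open>Multiplying a reduced monomial by \<open>x\<^sub>j\<close> either leaves it reduced or produces the power
  \<open>x\<^sub>j\<^bsup>degree (F j)\<^esup>\<close>, whose product with the leading coefficient the relation rewrites to lower powers.\<close>

lemma tame_lead_Var:
  assumes j: "j \<notin> T"
  shows "tame (lead_coeff (F j) * Var j)"
proof -
  let ?s = "degree (F j)"
  have cp: "coeff (F j) l \<in> polys T" for l using F_coeffs[OF j] unfolding coeffs_in_def by blast
  obtain \<kappa> where k: "\<And>l u w. l \<le> ?s \<Longrightarrow> w \<in> reduced_span u \<Longrightarrow> coeff (F j) l * w \<in> reduced_span (u + \<kappa>)"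
    using tame_common[OF finite_atMost[of ?s], of "coeff (F j)"] tame_polys[OF cp] by (metis atMost_iff)
  have "lead_coeff (F j) * Var j * w \<in> reduced_span (u + \<kappa>)" if "w \<in> reduced_span u" for u w
    using _ that
  proof (rule reduced_span_mult_generators)
    fix b assume "b \<in> reduced_monomials u"
    then obtain e where b: "b = Poly_Mapping.single e 1" and e: "\<forall>i\<in>T. Poly_Mapping.lookup e i \<le> u"
      "\<forall>i. i \<notin> T \<longrightarrow> Poly_Mapping.lookup e i < degree (F i)" unfolding reduced_monomials_def by blast
    \<comment> \<open>The exponent with its \<open>j\<close>-th entry set to \<open>0\<close>.\<close>
    define e' where "e' = e - Poly_Mapping.single j (Poly_Mapping.lookup e j)"
    have inB: "Var j ^ l * Poly_Mapping.single e' 1 \<in> reduced_monomials u" if "l < ?s" for l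
    proof -
      have "Var j ^ l * Poly_Mapping.single e' (1::complex) = Poly_Mapping.single (Poly_Mapping.single j l + e') 1"
        by (simp add: Var_power mult_single)
      then show ?thesis using e j that unfolding reduced_monomials_def e'_def
        by (auto simp: lookup_add lookup_minus lookup_single when_def intro!: imageI)
    qed
    have ee: "e = Poly_Mapping.single j (Poly_Mapping.lookup e j) + e'"
      unfolding e'_def by (rule poly_mapping_eqI) (simp add: lookup_add lookup_minus lookup_single when_def)
    have b': "b = Var j ^ Poly_Mapping.lookup e j * Poly_Mapping.single e' 1"
      unfolding b by (subst ee) (simp add: Var_power mult_single)
    show "lead_coeff (F j) * Var j * b \<in> reduced_span (u + \<kappa>)"
    proof (cases "Suc (Poly_Mapping.lookup e j) < ?s")
      case True
      have "lead_coeff (F j) * (Var j ^ Suc (Poly_Mapping.lookup e j) * Poly_Mapping.single e' 1) \<in> reduced_span (u + \<kappa>)"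
        by (intro k reduced_span_closed(6) inB True) simp
      then show ?thesis unfolding b' by (simp add: mult_ac)
    next
      case False
      then have s: "?s = Suc (Poly_Mapping.lookup e j)" using e(2) j by (simp add: Suc_le_eq le_antisym not_less)
      let ?m = "Poly_Mapping.single e' (1::complex)"
      have "poly (F j) (Var j) = (\<Sum>l<?s. coeff (F j) l * Var j ^ l) + lead_coeff (F j) * Var j ^ ?s"
        unfolding poly_altdef by (simp add: lessThan_Suc_atMost[symmetric])
      then have "lead_coeff (F j) * Var j ^ ?s * ?m = poly (F j) (Var j) * ?m - (\<Sum>l<?s. coeff (F j) l * (Var j ^ l * ?m))"
        by (simp add: distrib_right sum_distrib_right mult.assoc)
      also have "\<dots> \<in> reduced_span (u + \<kappa>)"
      proof (intro reduced_span_closed(4))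
        show "poly (F j) (Var j) * ?m \<in> reduced_span (u + \<kappa>)"
          by (rule reduced_span_closed(7)[OF ideal_closed(4)[OF prime_idealD(1)[OF Q] F_rel[OF j]]])
        show "(\<Sum>l<?s. coeff (F j) l * (Var j ^ l * ?m)) \<in> reduced_span (u + \<kappa>)"
          by (intro reduced_span_closed(5) k reduced_span_closed(6) inB) auto
      qed
      finally show ?thesis unfolding b' using s by (simp add: mult_ac)
    qed
  qed
  then show ?thesis unfolding tame_def by blast
qed

definition denom :: "('i, complex) mpoly" where "denom = (\<Prod>j\<in>- T. lead_coeff (F j))"

lemma denom_notin: "denom \<notin> Q"
  unfolding denom_def by (rule prime_prod_notin[OF Q]) (simp_all add: F_lead)

lemma tame_lead: "j \<notin> T \<Longrightarrow> tame (lead_coeff (F j))"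
  using F_coeffs tame_polys unfolding coeffs_in_def by blast

lemma tame_denom: "tame denom"
  unfolding denom_def by (rule tame_prod) (simp add: tame_lead)

lemma tame_denom_Var: "tame (denom * Var j)"
proof (cases "j \<in> T")
  case True then show ?thesis by (intro tame_mult tame_denom tame_Var)
next
  case False
  then have "denom = lead_coeff (F j) * (\<Prod>i\<in>- T - {j}. lead_coeff (F i))"
    unfolding denom_def by (intro prod.remove) auto
  then have "denom * Var j = (\<Prod>i\<in>- T - {j}. lead_coeff (F i)) * (lead_coeff (F j) * Var j)"
    by (simp add: mult_ac)
  also have "tame \<dots>" by (intro tame_mult tame_prod tame_lead_Var False) (simp add: tame_lead)
  finally show ?thesis .
qed

lemma tame_denom_power: "\<exists>L. tame (denom ^ L * p)"
proof -
  have "p \<in> polys UNIV" by simp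
  then show ?thesis
  proof induction
    case (Const c) show ?case by (rule exI[of _ 0]) (simp add: tame_Const)
  next
    case (Var i) show ?case by (rule exI[of _ 1]) (simp add: tame_denom_Var)
  next
    case (add p q)
    then obtain L M where "tame (denom ^ L * p)" "tame (denom ^ M * q)" by blast
    then have "tame (denom ^ M * (denom ^ L * p) + denom ^ L * (denom ^ M * q))"
      by (intro tame_add[OF tame_mult[OF tame_power[OF tame_denom]] tame_mult[OF tame_power[OF tame_denom]]])
    then show ?case by (intro exI[of _ "L + M"]) (simp add: power_add algebra_simps)
  next
    case (mult p q)
    then obtain L M where "tame (denom ^ L * p)" "tame (denom ^ M * q)" by blast
    then have "tame ((denom ^ L * p) * (denom ^ M * q))" by (rule tame_mult)
    then show ?case by (intro exI[of _ "L + M"]) (simp add: power_add mult_ac)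
  qed
qed

lemma reduced_span_one: "1 \<in> reduced_span 0"
proof -
  have "Poly_Mapping.single 0 1 \<in> reduced_monomials 0" unfolding reduced_monomials_def using F_deg
    by (intro image_eqI[where x = 0]) auto
  then show ?thesis by (intro reduced_span_closed(6)) simp
qed

end

text \<open>The monomials in \<open>g\<^sub>0, \<dots>, g\<^sub>n\<^sub>-\<^sub>1\<close>. Exponents are lists, read from the end: the last entry belongs to \<open>g\<^sub>0\<close>.
  So prepending an entry adds the next factor without renumbering the others.\<close>

primrec monomial_of :: "(nat \<Rightarrow> 'a::comm_ring_1) \<Rightarrow> nat list \<Rightarrow> 'a" where
  "monomial_of g [] = 1"
| "monomial_of g (l # b) = monomial_of g b * g (length b) ^ l"

definition exponents :: "nat \<Rightarrow> nat \<Rightarrow> nat list set" where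
  "exponents t n = {b. set b \<subseteq> {..t} \<and> length b = n}"

lemma exponents_finite: "finite (exponents t n)" and card_exponents: "card (exponents t n) = (t + 1) ^ n"
  unfolding exponents_def by (simp_all add: finite_lists_length_eq card_lists_length_eq)

context algebraic_over
begin

text \<open>More than \<open>card T\<close> polynomials satisfy an algebraic relation modulo \<open>Q\<close>. Choose a power \<open>A\<close> of the
  denominator such that \<open>A\<close> and all \<open>A g\<^sub>i\<close> are tame with a common constant \<open>\<kappa>\<close>. Then \<open>A\<^bsup>tn\<^esup>\<close> times each of
  the \<open>(t + 1)\<^sup>n\<close> monomials lies in a space of dimension at most \<open>(\<kappa>tn + 1)\<^bsup>card T\<^esup> K\<close> modulo \<open>Q\<close>, with \<open>K\<close>
  independent of \<open>t\<close>. For large \<open>t\<close> this is less than the number of monomials.\<close>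

lemma monomials_dependent:
  fixes g :: "nat \<Rightarrow> ('i, complex) mpoly"
  assumes "card T < n"
  shows "\<exists>t r. (\<exists>b\<in>exponents t n. r b \<noteq> 0) \<and> (\<Sum>b\<in>exponents t n. Const (r b) * monomial_of g b) \<in> Q"
proof -
  obtain L where L: "\<And>i. tame (denom ^ L i * g i)"
    using choice[of "\<lambda>i L. tame (denom ^ L * g i)"] tame_denom_power by blast
  define A where "A = denom ^ (\<Sum>i<n. L i)"
  have AQ: "A \<notin> Q" unfolding A_def using denom_notin prime_idealD(4)[OF Q] by blast
  have tA: "tame A" unfolding A_def by (rule tame_power[OF tame_denom])
  have tg: "tame (A * g i)" if "i < n" for i
  proof -
    have "L i \<le> (\<Sum>i<n. L i)" using that by (intro member_le_sum) auto
    then have "A = denom ^ ((\<Sum>i<n. L i) - L i) * denom ^ L i"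
      unfolding A_def by (simp add: power_add[symmetric])
    then have "A * g i = denom ^ ((\<Sum>i<n. L i) - L i) * (denom ^ L i * g i)" by (simp add: mult.assoc)
    then show ?thesis using tame_mult[OF tame_power[OF tame_denom] L] by metis
  qed
  obtain \<kappa>1 where k1: "\<And>i u w. i < n \<Longrightarrow> w \<in> reduced_span u \<Longrightarrow> A * g i * w \<in> reduced_span (u + \<kappa>1)"
    using tame_common[of "{..<n}" "\<lambda>i. A * g i"] tg by (metis finite_lessThan lessThan_iff)
  obtain \<kappa>2 where k2: "\<And>u w. w \<in> reduced_span u \<Longrightarrow> A * w \<in> reduced_span (u + \<kappa>2)" using tA unfolding tame_def by blast
  define \<kappa> where "\<kappa> = \<kappa>1 + \<kappa>2"
  have kg: "A * g i * w \<in> reduced_span (u + \<kappa>)" if "i < n" "w \<in> reduced_span u" for i u w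
    using reduced_span_mono[OF _ k1[OF that]] unfolding \<kappa>_def by simp
  have kA: "A * w \<in> reduced_span (u + \<kappa>)" if "w \<in> reduced_span u" for u w
    using reduced_span_mono[OF _ k2[OF that]] unfolding \<kappa>_def by simp
  have pow: "A ^ t * g i ^ l * w \<in> reduced_span (u + \<kappa> * t)" if "i < n" "w \<in> reduced_span u" "l \<le> t" for i u w t l
    using that(3)
  proof (induction t arbitrary: l)
    case 0 then show ?case using that by simp
  next
    case (Suc t)
    show ?case
    proof (cases l)
      case 0
      have "A * (A ^ t * g i ^ 0 * w) \<in> reduced_span (u + \<kappa> * t + \<kappa>)" by (intro kA Suc.IH) simp
      then show ?thesis using 0 by (simp add: mult_ac add_ac)
    next
      case (Suc l')
      have "A * g i * (A ^ t * g i ^ l' * w) \<in> reduced_span (u + \<kappa> * t + \<kappa>)"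
        using Suc Suc.prems by (intro kg that Suc.IH) simp
      then show ?thesis using Suc by (simp add: mult_ac add_ac)
    qed
  qed
  have mon: "A ^ (t * length b) * monomial_of g b \<in> reduced_span (\<kappa> * t * length b)"
    if "set b \<subseteq> {..t}" "length b \<le> n" for t b
    using that
  proof (induction b)
    case Nil then show ?case using reduced_span_one by simp
  next
    case (Cons l b)
    have "A ^ t * g (length b) ^ l * (A ^ (t * length b) * monomial_of g b) \<in> reduced_span (\<kappa> * t * length b + \<kappa> * t)"
      using Cons by (intro pow) auto
    then show ?case by (simp add: power_add mult_ac add_ac)
  qed
  define K where "K = (\<Prod>i\<in>- T. degree (F i))"
  \<comment> \<open>With this \<open>t\<close> the dimension is at most \<open>(t + 1)\<^bsup>card T\<^esup> t\<close>.\<close>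
  define t where "t = (\<kappa> * n + 1) ^ card T * K"
  let ?E = "exponents t n"
  have "card (reduced_monomials (\<kappa> * t * n)) \<le> (\<kappa> * t * n + 1) ^ card T * K" unfolding K_def by (rule card_reduced_monomials(2))
  also have "\<dots> \<le> ((\<kappa> * n + 1) * (t + 1)) ^ card T * K"
    by (intro mult_right_mono power_mono) (simp_all add: algebra_simps)
  also have "\<dots> = (t + 1) ^ card T * t" unfolding t_def power_mult_distrib by (simp only: mult_ac)
  also have "\<dots> < (t + 1) ^ card T * (t + 1)" by simp
  also have "\<dots> = (t + 1) ^ Suc (card T)" by simp
  also have "\<dots> \<le> (t + 1) ^ n" using assms by (intro power_increasing) auto
  finally have lt: "card (reduced_monomials (\<kappa> * t * n)) < card ?E" by (simp add: card_exponents)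
  have sp: "A ^ (t * n) * monomial_of g b \<in> mp.span (reduced_monomials (\<kappa> * t * n) \<union> Q)" if "b \<in> ?E" for b
    using mon[of b t] that unfolding exponents_def reduced_span_def by auto
  have "\<exists>r. (\<exists>b\<in>?E. r b \<noteq> 0) \<and> (\<Sum>b\<in>?E. Const (r b) * (A ^ (t * n) * monomial_of g b)) \<in> Q"
    by (rule linear_dependence_mod[OF prime_idealD(1)[OF Q] exponents_finite card_reduced_monomials(1) lt]) (rule sp)
  then obtain r where r: "\<exists>b\<in>?E. r b \<noteq> 0" "(\<Sum>b\<in>?E. Const (r b) * (A ^ (t * n) * monomial_of g b)) \<in> Q"
    by (elim exE conjE) (rule that)
  have "(\<Sum>b\<in>?E. Const (r b) * (A ^ (t * n) * monomial_of g b)) =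
      A ^ (t * n) * (\<Sum>b\<in>?E. Const (r b) * monomial_of g b)"
    by (simp add: sum_distrib_left mult.left_commute)
  then have "A ^ (t * n) * (\<Sum>b\<in>?E. Const (r b) * monomial_of g b) \<in> Q" using r(2) by simp
  moreover have "A ^ (t * n) \<notin> Q" using AQ prime_idealD(4)[OF Q] by blast
  ultimately have "(\<Sum>b\<in>?E. Const (r b) * monomial_of g b) \<in> Q"
    by (simp only: prime_idealD(3)[OF Q] simp_thms)
  with r(1) show ?thesis by (intro exI conjI)
qed

end

lemma Const_in_prime:
  fixes Q :: "('i::finite, complex) mpoly set"
  assumes "is_prime_ideal Q" "Const c \<in> Q"
  shows "c = 0"
  using constants_prime[OF assms(1) polys.Const assms(2), of 0] by simp

text \<open>As \<open>g\<close> lies in the larger ideal \<open>P'\<close>, the relation gives \<open>h 0 \<in> P'\<close>, so \<open>h 0 = 0\<close>. As \<open>g\<close> is not in the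
  prime \<open>P\<close>, one factor \<open>g\<close> can be cancelled from the rest, and the argument repeats.\<close>

lemma power_sum_in_prime:
  assumes P: "is_prime_ideal P" and P': "is_ideal P'" "P \<subseteq> P'" and g: "g \<in> P'" "g \<notin> P"
    and h: "\<And>l. h l \<in> P' \<Longrightarrow> h l = 0" and sum: "(\<Sum>l\<le>t. h l * g ^ l) \<in> P"
  shows "l \<le> t \<Longrightarrow> h l = (0::'a::comm_ring_1)"
  using h sum
proof (induction t arbitrary: h l)
  case 0 then show ?case using P'(2) by auto
next
  case (Suc t)
  let ?S = "\<Sum>l\<le>t. h (Suc l) * g ^ l"
  have eq: "(\<Sum>l\<le>Suc t. h l * g ^ l) = h 0 + ?S * g"
    by (subst sum.atMost_Suc_shift) (simp only: power_Suc2 power_0 mult_1_right mult.assoc[symmetric] sum_distrib_right[symmetric])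
  have "h 0 = (\<Sum>l\<le>Suc t. h l * g ^ l) - ?S * g" using eq by simp
  also have "\<dots> \<in> P'" using Suc.prems(3) P'(2)
    by (intro ideal_closed(6)[OF P'(1)] ideal_closed(3)[OF P'(1) g(1)]) blast
  finally have h0: "h 0 = 0" by (rule Suc.prems(2))
  then have "?S * g \<in> P" using Suc.prems(3) eq by simp
  then have "?S \<in> P" using prime_idealD(3)[OF P] g(2) by blast
  then have "h (Suc k) = 0" if "k \<le> t" for k
    using Suc.IH[OF that, of "\<lambda>l. h (Suc l)"] Suc.prems(2) by blast
  then show ?case using h0 Suc.prems(1) by (cases l) auto
qed

text \<open>Picking one element \<open>g\<^sub>i\<close> for each strict inclusion in a chain of primes gives algebraically independent
  elements modulo the smallest prime: collect a relation by powers of the last \<open>g\<^sub>i\<close>; its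
  coefficients are combinations of monomials in the earlier elements, to which the induction
  hypothesis for the next larger prime applies.\<close>

lemma monomials_independent:
  fixes P :: "nat \<Rightarrow> ('i::finite, complex) mpoly set"
  assumes P: "\<And>i. i \<le> n \<Longrightarrow> is_prime_ideal (P i)" and sub: "\<And>i. i < n \<Longrightarrow> P (Suc i) \<subseteq> P i"
    and g: "\<And>i. i < n \<Longrightarrow> g i \<in> P i - P (Suc i)"
  shows "i \<le> n \<Longrightarrow> (\<Sum>b\<in>exponents t i. Const (r b) * monomial_of g b) \<in> P i \<Longrightarrow> b \<in> exponents t i \<Longrightarrow> r b = 0"
proof (induction i arbitrary: r b)
  case 0
  have E: "exponents t 0 = {[]}" unfolding exponents_def by auto
  then show ?case using 0 Const_in_prime[OF P[of 0]] by simp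
next
  case (Suc i)
  have E: "exponents t (Suc i) = (\<lambda>(l, b). l # b) ` ({..t} \<times> exponents t i)"
    unfolding exponents_def lists_length_Suc_eq by (auto simp: length_Suc_conv image_iff)
  define h where "h l = (\<Sum>b\<in>exponents t i. Const (r (l # b)) * monomial_of g b)" for l
  have "(\<Sum>b\<in>exponents t (Suc i). Const (r b) * monomial_of g b) =
      (\<Sum>(l, b)\<in>{..t} \<times> exponents t i. Const (r (l # b)) * monomial_of g (l # b))"
    unfolding E by (subst sum.reindex) (auto simp: inj_on_def case_prod_unfold)
  also have "\<dots> = (\<Sum>l\<le>t. \<Sum>b\<in>exponents t i. Const (r (l # b)) * monomial_of g (l # b))"
    by (rule sum.cartesian_product[symmetric])
  also have "\<dots> = (\<Sum>l\<le>t. h l * g i ^ l)"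
    unfolding h_def sum_distrib_right by (intro sum.cong) (auto simp: exponents_def mult.assoc)
  finally have sumP: "(\<Sum>l\<le>t. h l * g i ^ l) \<in> P (Suc i)" using Suc.prems(2) by simp
  have i: "i < n" "i \<le> n" using Suc.prems(1) by auto
  have rh: "r (l # b) = 0" if "h l \<in> P i" "b \<in> exponents t i" for l b
    using Suc.IH[OF i(2), of "\<lambda>b. r (l # b)"] that unfolding h_def by blast
  have h0: "h l = 0" if "h l \<in> P i" for l
    unfolding h_def using rh[OF that] by (simp add: Const_0)
  have z: "h l = 0" if "l \<le> t" for l
    by (rule power_sum_in_prime[OF P[OF Suc.prems(1)] prime_idealD(1)[OF P[OF i(2)]] sub[OF i(1)] _ _ h0 sumP that])
      (use g[OF i(1)] in auto)
  obtain l b' where b: "b = l # b'" "l \<le> t" "b' \<in> exponents t i" using Suc.prems(3) unfolding E by auto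
  have "h l \<in> P i" using z[OF b(2)] ideal_closed(1)[OF prime_idealD(1)[OF P[OF i(2)]]] by simp
  then show ?case using rh b by blast
qed

lemma algebraic_relation:
  fixes Q :: "('i::finite, complex) mpoly set"
  assumes Q: "is_prime_ideal Q" and n: "\<not> indep_mod (insert j T) Q" and T: "indep_mod T Q"
  shows "\<exists>F. coeffs_in (polys T) F \<and> poly F (Var j) \<in> Q \<and> lead_coeff F \<notin> Q \<and> 0 < degree F"
proof -
  obtain p x where p: "p \<in> polys (insert j T)" "p \<in> Q" "mpoly_eval p x \<noteq> 0"
    using n unfolding indep_mod_def by blast
  obtain F where F: "coeffs_in (polys T) F" "p = poly F (Var j)" using polys_insert[OF p(1)] by blast
  have "\<not> coeffs_in Q F"
  proof
    assume "coeffs_in Q F"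
    then have "map_poly (\<lambda>q. mpoly_eval q x) F = 0"
      using F(1) T unfolding indep_mod_def coeffs_in_def by (intro poly_eqI) (simp add: coeff_map_poly)
    then show False using p(3) by (simp add: F(2) mpoly_eval_poly)
  qed
  then obtain F' where "minimal_relation (polys T) Q (Var j) F'"
    using minimal_relation_exists[OF subring_polys prime_idealD(1)[OF Q] F(1)] F(2) p(2) by blast
  then show ?thesis using minimal_relation_degree unfolding minimal_relation_def by blast
qed

text \<open>The monomials in elements chosen along the chain are linearly independent modulo \<open>P n\<close>, hence modulo the
  smaller ideal \<open>Q\<close>, whereas more than \<open>card T\<close> polynomials are algebraically dependent modulo \<open>Q\<close>.\<close>

lemma prime_chain_length_le:
  fixes P :: "nat \<Rightarrow> ('i::finite, complex) mpoly set"
  assumes Q: "is_prime_ideal Q" and T: "indep_mod T Q" "\<And>j. j \<notin> T \<Longrightarrow> \<not> indep_mod (insert j T) Q"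
    and P: "\<And>i. i \<le> n \<Longrightarrow> is_prime_ideal (P i)" "\<And>i. i < n \<Longrightarrow> P (Suc i) \<subset> P i" "Q \<subseteq> P n"
  shows "n \<le> card T"
proof (rule ccontr)
  assume "\<not> ?thesis"
  then have n: "card T < n" by simp
  obtain F where F: "\<And>j. j \<notin> T \<Longrightarrow> coeffs_in (polys T) (F j) \<and> poly (F j) (Var j) \<in> Q \<and>
      lead_coeff (F j) \<notin> Q \<and> 0 < degree (F j)"
    using algebraic_relation[OF Q T(2) T(1)] by metis
  interpret algebraic_over T Q F by unfold_locales (use Q F in auto)
  have "\<exists>g. g \<in> P i - P (Suc i)" if "i < n" for i using P(2)[OF that] by blast
  then obtain g where g: "\<And>i. i < n \<Longrightarrow> g i \<in> P i - P (Suc i)" by metis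
  obtain t r where tr: "\<exists>b\<in>exponents t n. r b \<noteq> 0" "(\<Sum>b\<in>exponents t n. Const (r b) * monomial_of g b) \<in> Q"
    using monomials_dependent[OF n] by blast
  have "\<And>b. b \<in> exponents t n \<Longrightarrow> r b = 0"
    using monomials_independent[where n = n and P = P and g = g and i = n and t = t and r = r] P g tr(2) by blast
  then show False using tr(1) by blast
qed

lemma indep_maximal_extension:
  assumes "indep_mod T0 Q"
  obtains T where "T0 \<subseteq> T" "indep_mod T Q" "\<And>j. j \<notin> T \<Longrightarrow> \<not> indep_mod (insert j T) Q"
proof -
  define \<T> where "\<T> = {T. T0 \<subseteq> T \<and> indep_mod T Q}"
  have "finite \<T>" "\<T> \<noteq> {}" using assms unfolding \<T>_def by auto
  from finite_has_maximal[OF this] obtain T where "T \<in> \<T>" and max: "\<forall>S\<in>\<T>. T \<subseteq> S \<longrightarrow> T = S" by metis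
  then have T: "T0 \<subseteq> T" "indep_mod T Q" unfolding \<T>_def by auto
  have "\<not> indep_mod (insert j T) Q" if "j \<notin> T" for j using T(1) max that unfolding \<T>_def by blast
  then show ?thesis using that T by blast
qed

lemma vanishing_ideal_anti: "V \<subseteq> V' \<Longrightarrow> vanishing_ideal V' \<subseteq> vanishing_ideal V"
  unfolding vanishing_ideal_def by blast

lemma chain_length_le:
  assumes V: "closedin zariski V" "irreducible_in zariski V"
    and T: "indep_mod T (vanishing_ideal V)" "\<And>j. j \<notin> T \<Longrightarrow> \<not> indep_mod (insert j T) (vanishing_ideal V)"
    and ch: "has_chain V n"
  shows "n \<le> card T"
proof -
  obtain Z where Z: "\<And>i. i \<le> n \<Longrightarrow> closedin zariski (Z i)" "\<And>i. i \<le> n \<Longrightarrow> irreducible_in zariski (Z i)"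
    "\<And>i. i \<le> n \<Longrightarrow> Z i \<subseteq> V" "\<And>i. i < n \<Longrightarrow> Z i \<subset> Z (Suc i)"
    using ch unfolding has_chain_def by metis
  show ?thesis
  proof (rule prime_chain_length_le[OF prime_vanishing_ideal[OF V] T, of n "\<lambda>i. vanishing_ideal (Z i)"])
    show "is_prime_ideal (vanishing_ideal (Z k))" if "k \<le> n" for k
      by (rule prime_vanishing_ideal[OF Z(1)[OF that] Z(2)[OF that]])
    show "vanishing_ideal V \<subseteq> vanishing_ideal (Z n)" by (rule vanishing_ideal_anti[OF Z(3)[OF order_refl]])
    fix i assume i: "i < n"
    have "vanishing_ideal (Z (Suc i)) \<subseteq> vanishing_ideal (Z i)" using Z(4)[OF i] by (intro vanishing_ideal_anti) blast
    moreover have "vanishing_ideal (Z (Suc i)) \<noteq> vanishing_ideal (Z i)"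
    proof
      assume "vanishing_ideal (Z (Suc i)) = vanishing_ideal (Z i)"
      then have "zero_locus (vanishing_ideal (Z (Suc i))) = zero_locus (vanishing_ideal (Z i))" by simp
      then have "Z (Suc i) = Z i" using zero_locus_vanishing_ideal Z(1) i by (metis Suc_leI less_imp_le)
      then show False using Z(4)[OF i] by blast
    qed
    ultimately show "vanishing_ideal (Z (Suc i)) \<subset> vanishing_ideal (Z i)" by blast
  qed
qed

text \<open>Apply the bound to the largest member of the chain, which is irreducible; independence on it implies
  independence on \<open>V\<close>.\<close>

lemma indep_of_has_chain:
  assumes "has_chain V n"
  shows "\<exists>T. indep_mod T (vanishing_ideal V) \<and> n \<le> card T"
proof -
  obtain Z where Z: "\<And>i. i \<le> n \<Longrightarrow> closedin zariski (Z i)" "\<And>i. i \<le> n \<Longrightarrow> irreducible_in zariski (Z i)"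
    "\<And>i. i \<le> n \<Longrightarrow> Z i \<subseteq> V" "\<And>i. i < n \<Longrightarrow> Z i \<subset> Z (Suc i)"
    using assms unfolding has_chain_def by metis
  have sub: "Z i \<subseteq> Z n" if "i \<le> n" for i
    using that by (induction rule: inc_induct) (use Z(4) in blast)+
  have ch: "has_chain (Z n) n" unfolding has_chain_def using Z sub by (intro exI[of _ Z]) blast
  have "is_prime_ideal (vanishing_ideal (Z n))" using Z(1,2) by (intro prime_vanishing_ideal) auto
  then have "indep_mod {} (vanishing_ideal (Z n))" unfolding indep_mod_def using constants_prime by blast
  then obtain T where T: "indep_mod T (vanishing_ideal (Z n))"
    "\<And>j. j \<notin> T \<Longrightarrow> \<not> indep_mod (insert j T) (vanishing_ideal (Z n))"
    using indep_maximal_extension by metis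
  have "n \<le> card T" by (rule chain_length_le[OF Z(1)[OF order_refl] Z(2)[OF order_refl] T ch])
  moreover have "indep_mod T (vanishing_ideal V)"
    using T(1) vanishing_ideal_anti[OF Z(3)[OF order_refl]] unfolding indep_mod_def by blast
  ultimately show ?thesis by blast
qed

section \<open>The incidence variety\<close>

lemma codim_eq_iff:
  fixes V :: "(complex ^ 'i::finite) set"
  assumes "closedin zariski V"
  shows "codim V = ereal (real r) \<longleftrightarrow>
    (\<exists>d. has_chain V d \<and> d + r = CARD('i)) \<and> (\<forall>d. has_chain V d \<longrightarrow> d + r \<le> CARD('i))"
proof -
  let ?S = "{ereal (real d) | d. has_chain V d}"
  have "codim V = ereal (real r) \<longleftrightarrow> Sup ?S = ereal (real CARD('i) - real r)"
    unfolding codim_def krull_dim_eq_chain[OF assms] by (cases "Sup ?S") auto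
  also have "\<dots> \<longleftrightarrow> (\<exists>d. has_chain V d \<and> d + r = CARD('i)) \<and> (\<forall>d. has_chain V d \<longrightarrow> d + r \<le> CARD('i))"
  proof
    assume S: "Sup ?S = ereal (real CARD('i) - real r)"
    have le: "d + r \<le> CARD('i)" if "has_chain V d" for d
    proof -
      have "ereal (real d) \<le> Sup ?S" using that by (intro Sup_upper) blast
      then show ?thesis unfolding S by simp
    qed
    have "ereal (real CARD('i) - real r - 1) < Sup ?S" unfolding S by simp
    then obtain d where d: "has_chain V d" "ereal (real CARD('i) - real r - 1) < ereal (real d)"
      unfolding less_Sup_iff by blast
    have "d + r = CARD('i)" using le[OF d(1)] d(2) by simp
    then show "(\<exists>d. has_chain V d \<and> d + r = CARD('i)) \<and> (\<forall>d. has_chain V d \<longrightarrow> d + r \<le> CARD('i))"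
      using le d(1) by blast
  next
    assume *: "(\<exists>d. has_chain V d \<and> d + r = CARD('i)) \<and> (\<forall>d. has_chain V d \<longrightarrow> d + r \<le> CARD('i))"
    then obtain d where d: "has_chain V d" "d + r = CARD('i)" by blast
    have e: "real CARD('i) - real r = real d" using d(2) by linarith
    have "d' \<le> d" if "has_chain V d'" for d'
    proof -
      have "d' + r \<le> CARD('i)" using * that by blast
      then show ?thesis using d(2) by linarith
    qed
    then show "Sup ?S = ereal (real CARD('i) - real r)" unfolding e
      using d(1) by (intro Sup_eqI) auto
  qed
  finally show ?thesis .
qed

lemma specialize_eval:
  "mpoly_eval (specialize F \<beta>) x =
    (\<Sum>a\<in>Poly_Mapping.keys F. mpoly_eval (Poly_Mapping.lookup F a) \<beta> * monom_eval a x)"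
proof -
  have "mpoly_eval (specialize F \<beta>) x =
      (\<Sum>a\<in>Poly_Mapping.keys F. Poly_Mapping.lookup (specialize F \<beta>) a * monom_eval a x)"
    by (rule mpoly_eval_superset) (auto simp: specialize_def in_keys_iff map.rep_eq when_def)
  then show ?thesis by (auto intro!: sum.cong simp: specialize_def map.rep_eq when_def)
qed

text \<open>The monomials of \<open>specialize F \<beta>\<close> depend on \<open>\<beta>\<close>, as coefficients may vanish. Summing over the
  monomials of \<open>F\<close> itself removes this dependence.\<close>

lemma specialize_eval_polynomial:
  fixes \<phi> :: "complex ^ 'a::finite \<Rightarrow> complex ^ 'n::finite" and \<psi> :: "complex ^ 'a \<Rightarrow> complex ^ 'k::finite"
  assumes "\<And>l. \<exists>q. \<forall>z. \<phi> z $ l = mpoly_eval q z" "\<And>l. \<exists>q. \<forall>z. \<psi> z $ l = mpoly_eval q z"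
  shows "\<exists>q. \<forall>z. mpoly_eval (specialize F (\<psi> z)) (\<phi> z) = mpoly_eval q z"
proof -
  have "\<exists>q\<in>polys UNIV. \<forall>z. mpoly_eval p (\<phi> z) = mpoly_eval q z" for p
    by (rule eval_substitute[of p UNIV]) (use assms(1) polys_UNIV in blast)+
  then obtain M where M: "\<And>p z. mpoly_eval p (\<phi> z) = mpoly_eval (M p) z" by metis
  have "\<exists>q\<in>polys UNIV. \<forall>z. mpoly_eval p (\<psi> z) = mpoly_eval q z" for p
    by (rule eval_substitute[of p UNIV]) (use assms(2) polys_UNIV in blast)+
  then obtain N where N: "\<And>p z. mpoly_eval p (\<psi> z) = mpoly_eval (N p) z" by metis
  have mon: "monom_eval a (\<phi> z) = mpoly_eval (M (Poly_Mapping.single a 1)) z" for a z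
    by (simp add: M[symmetric] mpoly_eval_single)
  show ?thesis
    by (rule exI[of _ "\<Sum>a\<in>Poly_Mapping.keys F. N (Poly_Mapping.lookup F a) * M (Poly_Mapping.single a 1)"])
      (simp add: specialize_eval mpoly_eval_sum N mon)
qed

definition solutions :: "('n::finite, 'k::finite, 'r::finite) param_system \<Rightarrow> complex ^ 'k \<Rightarrow> (complex ^ 'n) set" where
  "solutions f \<beta> = {x. system_eval f \<beta> x = 0}"

lemma closedin_solutions: "closedin zariski (solutions f \<beta>)"
proof -
  have "solutions f \<beta> = zero_locus (range (\<lambda>j. specialize (f j) \<beta>))"
    unfolding solutions_def zero_locus_def system_eval_def by (auto simp: vec_eq_iff)
  then show ?thesis by simp
qed

lemma incidence_variety_iff:
  "z \<in> incidence_variety f \<longleftrightarrow> (\<forall>i. point_of (proj_x z) i \<in> solutions f (proj_beta z))"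
  unfolding incidence_variety_def solutions_def by simp

lemma closedin_incidence_variety:
  fixes f :: "('n::finite, 'k::finite, 'r::finite) param_system"
  shows "closedin zariski (incidence_variety f :: (complex ^ (('m::finite \<times> 'n) + 'k)) set)"
proof -
  have ex: "\<exists>q. \<forall>z :: complex ^ (('m \<times> 'n) + 'k).
      mpoly_eval (specialize (f j) (proj_beta z)) (point_of (proj_x z) i) = mpoly_eval q z" for i j
  proof (rule specialize_eval_polynomial)
    show "\<exists>q. \<forall>z :: complex ^ (('m \<times> 'n) + 'k). point_of (proj_x z) i $ l = mpoly_eval q z" for l
      by (rule exI[of _ "Var (Inl (i, l))"]) (simp add: point_of_def proj_x_def)
    show "\<exists>q. \<forall>z :: complex ^ (('m \<times> 'n) + 'k). proj_beta z $ l = mpoly_eval q z" for l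
      by (rule exI[of _ "Var (Inr l)"]) (simp add: proj_beta_def)
  qed
  define q :: "'m \<Rightarrow> 'r \<Rightarrow> (('m \<times> 'n) + 'k, complex) mpoly" where
    "q i j = (SOME q. \<forall>z. mpoly_eval (specialize (f j) (proj_beta z)) (point_of (proj_x z) i) = mpoly_eval q z)" for i j
  have "mpoly_eval (specialize (f j) (proj_beta z)) (point_of (proj_x z) i) = mpoly_eval (q i j) z" for i j z
    using someI_ex[OF ex[of j i]] unfolding q_def by blast
  then have "incidence_variety f = zero_locus (range (\<lambda>(i, j). q i j))"
    unfolding incidence_variety_def zero_locus_def system_eval_def by (auto simp: vec_eq_iff)
  then show ?thesis by simp
qed

definition join :: "complex ^ ('m::finite \<times> 'n::finite) \<Rightarrow> complex ^ 'k::finite \<Rightarrow> complex ^ (('m \<times> 'n) + 'k)" where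
  "join x \<beta> = (\<chi> s. case s of Inl il \<Rightarrow> x $ il | Inr l \<Rightarrow> \<beta> $ l)"

lemma join_simps [simp]: "proj_x (join x \<beta>) = x" "proj_beta (join x \<beta>) = \<beta>"
  "join (proj_x z) (proj_beta z) = z" "join x \<beta> $ Inl il = x $ il" "join x \<beta> $ Inr l = \<beta> $ l"
  by (auto simp: join_def proj_x_def proj_beta_def vec_eq_iff split: sum.split)

definition replace_point :: "complex ^ ('m::finite \<times> 'n::finite) \<Rightarrow> 'm \<Rightarrow> complex ^ 'n \<Rightarrow> complex ^ ('m \<times> 'n)" where
  "replace_point x i w = (\<chi> s. if fst s = i then w $ snd s else x $ s)"

lemma replace_point_simps [simp]:
  "point_of (replace_point x i w) i = w" "i' \<noteq> i \<Longrightarrow> point_of (replace_point x i w) i' = point_of x i'"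
  "replace_point x i (point_of x i) = x" "replace_point x i w $ (i', l) = (if i' = i then w $ l else x $ (i', l))"
  by (auto simp: replace_point_def point_of_def vec_eq_iff)

text \<open>If \<open>S\<close> is independent on \<open>V\<^sub>\<beta>\<close>, then the \<open>m\<close> copies of \<open>S\<close> are independent on the power \<open>V\<^sub>\<beta>\<^sup>m\<close>. The points
  are freed one at a time: in the set \<open>J\<close> are the indices of the points that may already be arbitrary.
  With all points but the \<open>i\<close>-th fixed, \<open>p\<close> is a polynomial in the \<open>S\<close>-coordinates of the \<open>i\<close>-th point that
  vanishes on \<open>V\<^sub>\<beta>\<close>.\<close>

lemma vanishes_on_fibre:
  fixes f :: "('n::finite, 'k::finite, 'r::finite) param_system"
    and p :: "(('m::finite \<times> 'n) + 'k, complex) mpoly"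
  assumes p: "p \<in> polys (range Inr \<union> Inl ` (UNIV \<times> S))" "p \<in> vanishing_ideal (incidence_variety f)"
    and S: "indep_mod S (vanishing_ideal (solutions f \<beta>))"
  shows "mpoly_eval p (join x \<beta>) = 0"
proof -
  have "\<forall>x. (\<forall>i\<in>- J. point_of x i \<in> solutions f \<beta>) \<longrightarrow> mpoly_eval p (join x \<beta>) = 0" if "finite J" for J :: "'m set"
    using that
  proof (induction J)
    case empty
    show ?case
    proof (intro allI impI)
      fix x :: "complex ^ ('m \<times> 'n)" assume "\<forall>i\<in>- {}. point_of x i \<in> solutions f \<beta>"
      then have "join x \<beta> \<in> incidence_variety f" unfolding incidence_variety_iff by simp
      then show "mpoly_eval p (join x \<beta>) = 0" using p(2) unfolding vanishing_ideal_def by blast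
    qed
  next
    case (insert i J)
    show ?case
    proof (intro allI impI)
      fix x :: "complex ^ ('m \<times> 'n)" assume x: "\<forall>i'\<in>- insert i J. point_of x i' \<in> solutions f \<beta>"
      have "\<exists>q\<in>polys S. \<forall>w. mpoly_eval p (join (replace_point x i w) \<beta>) = mpoly_eval q w"
      proof (rule eval_substitute[OF p(1)])
        fix s :: "('m \<times> 'n) + 'k" assume s: "s \<in> range Inr \<union> Inl ` (UNIV \<times> S)"
        show "\<exists>q\<in>polys S. \<forall>w. join (replace_point x i w) \<beta> $ s = mpoly_eval q w"
        proof (cases s)
          case (Inr l)
          then show ?thesis by (intro bexI[of _ "Const (\<beta> $ l)"]) (auto intro: polys.Const)
        next
          case (Inl il)
          obtain i' l where il: "il = (i', l)" by (cases il)
          then have "l \<in> S" using s Inl by auto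
          then show ?thesis using Inl il
            by (intro bexI[of _ "if i' = i then Var l else Const (x $ (i', l))"]) (auto intro: polys.Const polys.Var)
        qed
      qed
      then obtain q where q: "q \<in> polys S" "\<And>w. mpoly_eval p (join (replace_point x i w) \<beta>) = mpoly_eval q w" by blast
      have "mpoly_eval q w = 0" if w: "w \<in> solutions f \<beta>" for w
      proof -
        have "\<forall>i'\<in>- J. point_of (replace_point x i w) i' \<in> solutions f \<beta>"
        proof
          fix i' assume "i' \<in> - J"
          then show "point_of (replace_point x i w) i' \<in> solutions f \<beta>" using x w by (cases "i' = i") auto
        qed
        then show ?thesis using insert.IH q(2)[of w] by simp
      qed
      then have "mpoly_eval q (point_of x i) = 0" using S q(1) unfolding indep_mod_def vanishing_ideal_def by blast
      then show "mpoly_eval p (join x \<beta>) = 0" using q(2)[of "point_of x i"] by simp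
    qed
  qed
  from this[of UNIV] show ?thesis by simp
qed

text \<open>One of finitely many sets \<open>S\<close> must serve a Zariski dense set of \<open>\<beta>\<close>: otherwise for each \<open>S\<close> a nonzero
  polynomial \<open>q\<^sub>S\<close> vanishes where \<open>S\<close> is admissible, and the product of \<open>u\<close> with all \<open>q\<^sub>S\<close> vanishes identically.\<close>

lemma common_indep_coordinates:
  fixes u :: "('k::finite, complex) mpoly" and ok :: "'n::finite set \<Rightarrow> complex ^ 'k \<Rightarrow> bool"
  assumes u: "mpoly_eval u \<beta>0 \<noteq> 0"
    and ok: "\<And>\<beta>. mpoly_eval u \<beta> \<noteq> 0 \<Longrightarrow> \<exists>S. ok S \<beta>"
  shows "\<exists>S. (\<exists>\<beta>. ok S \<beta>) \<and> (\<forall>q. (\<forall>\<beta>. ok S \<beta> \<longrightarrow> mpoly_eval q \<beta> = 0) \<longrightarrow> (\<forall>\<beta>. mpoly_eval q \<beta> = 0))"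
proof (rule ccontr)
  assume no: "\<not> ?thesis"
  have "\<exists>q. (\<exists>\<beta>. mpoly_eval q \<beta> \<noteq> 0) \<and> (\<forall>\<beta>. ok S \<beta> \<longrightarrow> mpoly_eval q \<beta> = 0)" for S
  proof (cases "\<exists>\<beta>. ok S \<beta>")
    case True then show ?thesis using no by blast
  next
    case False then show ?thesis by (intro exI[of _ 1]) auto
  qed
  then obtain q where q: "\<And>S. \<exists>\<beta>. mpoly_eval (q S) \<beta> \<noteq> 0" "\<And>S \<beta>. ok S \<beta> \<Longrightarrow> mpoly_eval (q S) \<beta> = 0" by metis
  from eval_prod_nonzero[of UNIV q, OF _ q(1)] obtain \<beta>1 where b1: "mpoly_eval (prod q UNIV) \<beta>1 \<noteq> 0" by auto
  obtain t where t: "mpoly_eval u (line_point \<beta>0 \<beta>1 t) \<noteq> 0" "mpoly_eval (prod q UNIV) (line_point \<beta>0 \<beta>1 t) \<noteq> 0"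
    by (rule common_nonzero_on_line[OF u b1])
  obtain S where "ok S (line_point \<beta>0 \<beta>1 t)" using ok[OF t(1)] by blast
  then have "mpoly_eval (q S) (line_point \<beta>0 \<beta>1 t) = 0" by (rule q(2))
  then show False using t(2) by (auto simp: prod_zero_iff)
qed

text \<open>A polynomial in \<open>T\<close> that vanishes on \<open>C\<close> vanishes on the whole \<open>\<complex>\<^bsup>mn\<^esup> \<times> {\<beta>}\<close> for each \<open>\<beta>\<close> in the dense set
  of parameters served by \<open>S\<close>. For fixed \<open>x\<close> it is a polynomial in \<open>\<beta>\<close>, so it vanishes everywhere.\<close>

lemma has_chain_incidence_variety:
  fixes f :: "('n::finite, 'k::finite, 'r::finite) param_system"
  assumes u: "mpoly_eval u \<beta>0 \<noteq> 0"
    and ch: "\<And>\<beta>. mpoly_eval u \<beta> \<noteq> 0 \<Longrightarrow> has_chain (solutions f \<beta>) d"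
  shows "\<exists>e \<ge> CARD('k) + CARD('m) * d. has_chain (incidence_variety f :: (complex ^ (('m::finite \<times> 'n) + 'k)) set) e"
proof -
  define ok where "ok S \<beta> \<longleftrightarrow> d \<le> card S \<and> indep_mod S (vanishing_ideal (solutions f \<beta>))" for S \<beta>
  have "\<exists>S. ok S \<beta>" if "mpoly_eval u \<beta> \<noteq> 0" for \<beta>
    using indep_of_has_chain[OF ch[OF that]] unfolding ok_def by blast
  from common_indep_coordinates[of u \<beta>0 ok, OF u this] obtain S where S: "\<exists>\<beta>. ok S \<beta>"
    "\<forall>q. (\<forall>\<beta>. ok S \<beta> \<longrightarrow> mpoly_eval q \<beta> = 0) \<longrightarrow> (\<forall>\<beta>. mpoly_eval q \<beta> = 0)" by blast
  let ?C = "incidence_variety f :: (complex ^ (('m \<times> 'n) + 'k)) set"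
  define T :: "(('m \<times> 'n) + 'k) set" where "T = range Inr \<union> Inl ` (UNIV \<times> S)"
  have "indep_mod T (vanishing_ideal ?C)"
    unfolding indep_mod_def
  proof (intro ballI allI)
    fix p and z :: "complex ^ (('m \<times> 'n) + 'k)" assume p: "p \<in> polys T \<inter> vanishing_ideal ?C"
    have "\<exists>q\<in>polys UNIV. \<forall>\<beta>. mpoly_eval p (join (proj_x z) \<beta>) = mpoly_eval q \<beta>"
    proof (rule eval_substitute[of p T])
      fix s :: "('m \<times> 'n) + 'k"
      show "\<exists>q\<in>polys UNIV. \<forall>\<beta>. join (proj_x z) \<beta> $ s = mpoly_eval q \<beta>"
      proof (cases s)
        case (Inr l) then show ?thesis by (intro bexI[of _ "Var l"]) auto
      next
        case (Inl il) then show ?thesis by (intro bexI[of _ "Const (proj_x z $ il)"]) auto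
      qed
    qed (use p in blast)
    then obtain q where q: "\<And>\<beta>. mpoly_eval p (join (proj_x z) \<beta>) = mpoly_eval q \<beta>" by blast
    have "mpoly_eval q \<beta> = 0" if "ok S \<beta>" for \<beta>
      using vanishes_on_fibre[of p S f \<beta> "proj_x z"] p q that unfolding ok_def T_def by simp
    then have "\<forall>\<beta>. mpoly_eval q \<beta> = 0" using S(2) by blast
    then show "mpoly_eval p z = 0" using q[of "proj_beta z"] by simp
  qed
  then have "has_chain ?C (card T)" by (rule has_chain_of_indep[OF closedin_incidence_variety])
  moreover have "card T = CARD('k) + CARD('m) * card S"
    unfolding T_def by (subst card_Un_disjoint) (auto simp: card_image card_cartesian_product)
  moreover have "d \<le> card S" using S(1) unfolding ok_def by blast
  ultimately show ?thesis by (intro exI[of _ "card T"]) simp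
qed

lemma params_indep:
  fixes C :: "(complex ^ (('m::finite \<times> 'n::finite) + 'k::finite)) set"
  assumes "zariski closure_of (proj_beta ` C) = UNIV"
  shows "indep_mod (range Inr) (vanishing_ideal C)"
  unfolding indep_mod_def
proof (intro ballI allI)
  fix p and z :: "complex ^ (('m \<times> 'n) + 'k)" assume p: "p \<in> polys (range Inr) \<inter> vanishing_ideal C"
  have "\<exists>q\<in>polys UNIV. \<forall>\<beta>. mpoly_eval p (join 0 \<beta>) = mpoly_eval q \<beta>"
  proof (rule eval_substitute[of p "range Inr"])
    fix s :: "('m \<times> 'n) + 'k" assume "s \<in> range Inr"
    then obtain l where "s = Inr l" by blast
    then show "\<exists>q\<in>polys UNIV. \<forall>\<beta>. join 0 \<beta> $ s = mpoly_eval q \<beta>"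
      by (intro bexI[of _ "Var l"]) auto
  qed (use p in blast)
  then obtain q where q: "\<And>\<beta>. mpoly_eval p (join 0 \<beta>) = mpoly_eval q \<beta>" by blast
  have pq: "mpoly_eval p z = mpoly_eval q (proj_beta z)" for z
    unfolding q[symmetric] using p by (intro eval_cong[of p "range Inr"]) (auto simp: proj_beta_def)
  have "proj_beta ` C \<subseteq> zero_locus {q}"
    using p pq unfolding vanishing_ideal_def zero_locus_def by auto
  then have "zariski closure_of (proj_beta ` C) \<subseteq> zero_locus {q}"
    by (rule closure_of_minimal) simp
  then have "proj_beta z \<in> zero_locus {q}" using assms by blast
  then show "mpoly_eval p z = 0" by (simp add: pq zero_locus_def)
qed

text \<open>By \<open>extend_point\<close> the points of \<open>\<complex>\<^sup>T\<close> where some \<open>a\<close> is nonzero lift to \<open>C\<close>. Fix \<open>\<beta>\<close> such that \<open>u\<close> is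
  nonzero at \<open>\<beta>\<close> and \<open>a\<close> at some point over \<open>\<beta>\<close>. As \<open>T\<close> contains all parameters, lifting a point does not
  move \<open>\<beta>\<close>, so the \<open>i\<close>-th component of a lifted point is in \<open>V\<^sub>\<beta>\<close>, with generic \<open>T\<close>-coordinates.\<close>

lemma fibre_indep:
  fixes f :: "('n::finite, 'k::finite, 'r::finite) param_system"
  defines "C \<equiv> incidence_variety f :: (complex ^ (('m::finite \<times> 'n) + 'k)) set"
  assumes irr: "irreducible_in zariski C" and T: "range Inr \<subseteq> T" "indep_mod T (vanishing_ideal C)"
    and u: "mpoly_eval u \<beta>0 \<noteq> 0"
  shows "\<exists>\<beta>. mpoly_eval u \<beta> \<noteq> 0 \<and> (\<forall>i. indep_mod {l. Inl (i, l) \<in> T} (vanishing_ideal (solutions f \<beta>)))"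
proof -
  let ?Q = "vanishing_ideal C"
  have cl: "closedin zariski C" unfolding C_def by (rule closedin_incidence_variety)
  have Q: "is_prime_ideal ?Q" by (rule prime_vanishing_ideal[OF cl irr])
  obtain a where a: "a \<in> polys T" "a \<notin> ?Q"
    and lift: "\<And>c. mpoly_eval a c \<noteq> 0 \<Longrightarrow> \<exists>c'\<in>C. \<forall>i\<in>T. c' $ i = c $ i"
    using extend_point[OF Q prime_idealD(2)[OF Q], of T] T(2)
    unfolding indep_mod_def zero_locus_vanishing_ideal[OF cl] by blast
  obtain z0 where z0: "mpoly_eval a z0 \<noteq> 0" using a(2) unfolding vanishing_ideal_def by blast
  have "\<exists>v\<in>polys UNIV. \<forall>z. mpoly_eval u (proj_beta z) = mpoly_eval (v :: (('m \<times> 'n) + 'k, complex) mpoly) z"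
    by (rule eval_substitute[of u UNIV])
      (auto intro!: bexI[of _ "Var (Inr _)"] simp: proj_beta_def)
  then obtain v :: "(('m \<times> 'n) + 'k, complex) mpoly" where v: "\<And>z. mpoly_eval u (proj_beta z) = mpoly_eval v z" by blast
  have "mpoly_eval v (join 0 \<beta>0) \<noteq> 0" using u by (simp add: v[symmetric])
  from common_nonzero_on_line[OF this z0] obtain z1 where z1: "mpoly_eval v z1 \<noteq> 0" "mpoly_eval a z1 \<noteq> 0" by blast
  let ?b = "proj_beta z1"
  have "indep_mod {l. Inl (i, l) \<in> T} (vanishing_ideal (solutions f ?b))" for i
    unfolding indep_mod_def
  proof (intro ballI allI, rule ccontr)
    fix p y assume p: "p \<in> polys {l. Inl (i, l) \<in> T} \<inter> vanishing_ideal (solutions f ?b)" and y: "mpoly_eval p y \<noteq> 0"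
    have "\<exists>p'\<in>polys UNIV. \<forall>z. mpoly_eval p (point_of (proj_x z) i) = mpoly_eval (p' :: (('m \<times> 'n) + 'k, complex) mpoly) z"
      by (rule eval_substitute[of p UNIV])
        (auto intro!: bexI[of _ "Var (Inl (i, _))"] simp: proj_x_def point_of_def)
    then obtain p' :: "(('m \<times> 'n) + 'k, complex) mpoly" where
      p': "\<And>z. mpoly_eval p (point_of (proj_x z) i) = mpoly_eval p' z" by blast
    \<comment> \<open>The line from \<open>?z\<close> to \<open>z1\<close> stays over the parameter \<open>?b\<close>, which both points share.\<close>
    let ?z = "join (replace_point (proj_x z1) i y) ?b"
    have "mpoly_eval p' ?z \<noteq> 0" using y by (simp add: p'[symmetric])
    from common_nonzero_on_line[OF this z1(2)] obtain t where
      t: "mpoly_eval p' (line_point ?z z1 t) \<noteq> 0" "mpoly_eval a (line_point ?z z1 t) \<noteq> 0" by blast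
    let ?w = "line_point ?z z1 t"
    have wb: "proj_beta ?w = ?b" by (simp add: proj_beta_def line_point_def vec_eq_iff)
    obtain c where c: "c \<in> C" "\<And>s. s \<in> T \<Longrightarrow> c $ s = ?w $ s" using lift[OF t(2)] by blast
    have "c $ Inr l = ?w $ Inr l" for l using T(1) by (intro c(2)) blast
    then have "proj_beta c = proj_beta ?w" by (simp add: proj_beta_def)
    then have "proj_beta c = ?b" using wb by (rule trans)
    then have "point_of (proj_x c) i \<in> solutions f ?b" using c(1) unfolding C_def incidence_variety_iff by metis
    then have "mpoly_eval p (point_of (proj_x c) i) = 0" using p unfolding vanishing_ideal_def by blast
    moreover have "mpoly_eval p (point_of (proj_x c) i) = mpoly_eval p (point_of (proj_x ?w) i)"
      using p c(2) by (intro eval_cong[of p "{l. Inl (i, l) \<in> T}"]) (auto simp: point_of_def proj_x_def)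
    ultimately show False using t(1) by (simp add: p')
  qed
  then show ?thesis using z1(1) by (intro exI[of _ ?b]) (simp add: v)
qed

text \<open>A maximal independent set \<open>T\<close> that contains the parameters consists of them and of sets \<open>S i\<close> of coordinates
  of the \<open>i\<close>-th point, and \<open>card (S i) \<le> d\<close> because \<open>S i\<close> is independent on a generic fibre.\<close>

lemma chain_length_incidence_variety:
  fixes f :: "('n::finite, 'k::finite, 'r::finite) param_system"
  defines "C \<equiv> incidence_variety f :: (complex ^ (('m::finite \<times> 'n) + 'k)) set"
  assumes irr: "irreducible_in zariski C" and dom: "zariski closure_of (proj_beta ` C) = UNIV"
    and u: "mpoly_eval u \<beta>0 \<noteq> 0"
    and bound: "\<And>\<beta> e. mpoly_eval u \<beta> \<noteq> 0 \<Longrightarrow> has_chain (solutions f \<beta>) e \<Longrightarrow> e \<le> d"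
    and ch: "has_chain C e"
  shows "e \<le> CARD('k) + CARD('m) * d"
proof -
  have cl: "closedin zariski C" unfolding C_def by (rule closedin_incidence_variety)
  obtain T where T: "range Inr \<subseteq> T" "indep_mod T (vanishing_ideal C)"
    "\<And>j. j \<notin> T \<Longrightarrow> \<not> indep_mod (insert j T) (vanishing_ideal C)"
    by (rule indep_maximal_extension[OF params_indep[OF dom]]) (rule that)
  define S where "S i = {l. Inl (i, l) \<in> T}" for i
  obtain \<beta> where b: "mpoly_eval u \<beta> \<noteq> 0" "\<And>i. indep_mod (S i) (vanishing_ideal (solutions f \<beta>))"
    using fibre_indep[where f = f and T = T, OF _ T(1) _ u] irr T(2) unfolding C_def S_def by blast
  have Sd: "card (S i) \<le> d" for i
    by (rule bound[OF b(1) has_chain_of_indep[OF closedin_solutions b(2)]])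
  have "T = range Inr \<union> Inl ` Sigma UNIV S"
  proof (rule set_eqI)
    fix s show "s \<in> T \<longleftrightarrow> s \<in> range Inr \<union> Inl ` Sigma UNIV S"
      using T(1) unfolding S_def by (cases s) auto
  qed
  then have "card T = CARD('k) + card (Sigma UNIV S)"
    by (simp only:) (subst card_Un_disjoint, auto simp: card_image)
  also have "card (Sigma UNIV S) = (\<Sum>i\<in>UNIV. card (S i))" by simp
  also have "\<dots> \<le> CARD('m) * d" using sum_bounded_above[of UNIV "\<lambda>i. card (S i)" d] Sd by simp
  finally have "card T \<le> CARD('k) + CARD('m) * d" by simp
  moreover have "e \<le> card T" by (rule chain_length_le[OF cl irr T(2,3) ch])
  ultimately show ?thesis by simp
qed

theorem proposition3p11:
  fixes f :: "('n::finite, 'k::finite, 'r::finite) param_system"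
    and C :: "(complex ^ (('m::finite \<times> 'n) + 'k)) set"
    and H :: "(complex ^ ('m \<times> 'n)) set"
  assumes C_def: "C = incidence_variety f"
    and H_def: "H = zariski closure_of (proj_x ` C)"
    and irreducible: "irreducible_in zariski C"
    and component: "\<exists>Z. irreducible_components zariski C = {Z} \<and>
          dominates proj_x Z H \<and> dominates proj_beta Z UNIV"
    and generic_ci: "generically (\<lambda>\<beta>. codim {x. system_eval f \<beta> x = 0} = ereal (real CARD('r)))"
  shows "codim C = ereal (real (CARD('m) * CARD('r)))"
proof -
  obtain Z where Z: "irreducible_components zariski C = {Z}" "dominates proj_beta Z UNIV"
    using component by blast
  have "Z \<subseteq> C" using Z(1) unfolding irreducible_components_def by blast
  then have "zariski closure_of (proj_beta ` Z) \<subseteq> zariski closure_of (proj_beta ` C)"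
    by (intro closure_of_mono image_mono)
  then have dom: "zariski closure_of (proj_beta ` C) = UNIV" using Z(2) unfolding dominates_def by blast
  obtain U where U: "openin zariski U" "U \<noteq> {}"
    "\<And>\<beta>. \<beta> \<in> U \<Longrightarrow> codim (solutions f \<beta>) = ereal (real CARD('r))"
    using generic_ci unfolding generically_def solutions_def by blast
  then obtain P \<beta>0 where P: "U = - zero_locus P" "\<beta>0 \<in> U" unfolding openin_zariski by blast
  then obtain u where u: "u \<in> P" "mpoly_eval u \<beta>0 \<noteq> 0" unfolding zero_locus_def by blast
  have fib: "codim (solutions f \<beta>) = ereal (real CARD('r))" if "mpoly_eval u \<beta> \<noteq> 0" for \<beta>
    using that u(1) P(1) by (intro U(3)) (auto simp: zero_locus_def)
  note fib' = fib[unfolded codim_eq_iff[OF closedin_solutions]]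
  \<comment> \<open>The dimension of the generic solution set; the subtraction does not truncate by \<open>rn\<close> below.\<close>
  define d where "d = CARD('n) - CARD('r)"
  have rn: "CARD('r) \<le> CARD('n)" using fib'[OF u(2)] by (metis le_add2)
  have ch: "has_chain (solutions f \<beta>) d" if nz: "mpoly_eval u \<beta> \<noteq> 0" for \<beta>
  proof -
    obtain d' where "has_chain (solutions f \<beta>) d'" "d' + CARD('r) = CARD('n)" using fib'[OF nz] by blast
    moreover from this have "d' = d" unfolding d_def by linarith
    ultimately show ?thesis by simp
  qed
  have bound: "e \<le> d" if "mpoly_eval u \<beta> \<noteq> 0" "has_chain (solutions f \<beta>) e" for \<beta> e
    using fib'[OF that(1)] that(2) unfolding d_def by (metis add_le_imp_le_diff)
  have upper: "e \<le> CARD('k) + CARD('m) * d" if "has_chain C e" for e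
    by (rule chain_length_incidence_variety[OF irreducible[unfolded C_def] dom[unfolded C_def] u(2) _
          that[unfolded C_def]]) (rule bound)
  obtain e where e: "CARD('k) + CARD('m) * d \<le> e" "has_chain C e"
    using has_chain_incidence_variety[OF u(2), of f d] ch unfolding C_def by blast
  have dn: "d + CARD('r) = CARD('n)" using rn unfolding d_def by simp
  have card: "CARD('k) + CARD('m) * d + CARD('m) * CARD('r) = CARD(('m \<times> 'n) + 'k)"
    unfolding add.assoc add_mult_distrib2[symmetric] dn by simp
  have "closedin zariski C" unfolding C_def by (rule closedin_incidence_variety)
  then show ?thesis
    unfolding codim_eq_iff[OF \<open>closedin zariski C\<close>] card[symmetric] using upper e le_antisym by fastforce
qed

end
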